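(* Let $(\mathcal A,I)$ be a hypergraph and let $E$ be a product functor on $\mathcal A$, with free presheaf $V$ and reduced free presheaf $\overline V$ over a commutative field $\mathbb K$. If $\mathcal A$ has the strong intersection property, then $V$ has an interaction decomposition. If $\mathcal A$ has the weak intersection property, then $\overline V$ has an interaction decomposition.
   Context: Hypergraph: $I$ is a set (not necessarily finite) and $\mathcal A$ is a set of finite subsets of $I$, viewed as a poset category with an arrow $\alpha\to\beta$ iff $\beta\subseteq\alpha$. Strong (resp. weak) intersection property: $\alpha\cap\alpha'\in\mathcal A$ for all $\alpha,\alpha'\in\mathcal A$ (resp. for all $\alpha,\alpha'\in\mathcal A$ with $\alpha\cap\alpha'\neq\emptyset$). Product functor: given non-empty sets $E_i$, $i\in I$ (not necessarily finite), $E$ is the covariant functor on $\mathcal A$ with $E_\alpha=\prod_{i\in\alpha}E_i$ (a singleton if $\alpha=\emptyset$), the maps $\pi^{\beta\alpha}:E_\alpha\to E_\beta$ for $\beta\subseteq\alpha$ being the (surjective) coordinate projections. Free presheaf: $V_\alpha=\mathbb K^{E_\alpha}$ is the space of all functions $E_\alpha\to\mathbb K$, with injective maps $j_{\alpha\beta}:V_\beta\to V_\alpha$, $f\mapsto f\circ\pi^{\beta\alpha}$ for $\alpha\to\beta$. Reduced free presheaf: $\overline V_\alpha=V_\alpha/\mathbb K_\alpha$, where $\mathbb K_\alpha$ is the line of constant functions, with the induced injective maps, again denoted $j_{\alpha\beta}$. Interaction decomposition of a presheaf of vector spaces $W$ on $\mathcal A$ with injective maps $j_{\alpha\beta}:W_\beta\to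 W_\alpha$: a family of subspaces $S_\gamma\subseteq W_\gamma$, $\gamma\in\mathcal A$, with $W_\alpha=\bigoplus_{\beta\in\mathcal A,\ \alpha\to\beta}j_{\alpha\beta}S_\beta$ for all $\alpha\in\mathcal A$. *)

theory Defs
  imports "HOL-Algebra.Module" "HOL-Algebra.QuotRing"
begin

section \<open>Hypergraphs\<close>

definition hypergraph :: "'i set set \<Rightarrow> 'i set \<Rightarrow> bool" where
  "hypergraph A I \<longleftrightarrow> (\<forall>\<alpha>\<in>A. finite \<alpha> \<and> \<alpha> \<subseteq> I)"

definition strong_intersection_property :: "'i set set \<Rightarrow> bool" where
  "strong_intersection_property A \<longleftrightarrow> (\<forall>\<alpha>\<in>A. \<forall>\<alpha>'\<in>A. \<alpha> \<inter> \<alpha>' \<in> A)"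

definition weak_intersection_property :: "'i set set \<Rightarrow> bool" where
  "weak_intersection_property A \<longleftrightarrow>
     (\<forall>\<alpha>\<in>A. \<forall>\<alpha>'\<in>A. \<alpha> \<inter> \<alpha>' \<noteq> {} \<longrightarrow> \<alpha> \<inter> \<alpha>' \<in> A)"


section \<open>Presheaves of vector spaces and interaction decompositions\<close>

text \<open>
  A vector space over \<open>K\<close> is a \<^locale>\<open>module\<close> over a record \<open>K\<close> satisfying \<^locale>\<open>field\<close>, and
  its subspaces are the \<^locale>\<open>submodule\<close>s. The module record extends the ring record; its
  fields \<open>mult\<close> and \<open>one\<close> play no role and are left undefined below.

  A presheaf on \<open>A\<close> is given by its spaces \<open>W \<alpha>\<close> and its maps \<open>j \<alpha> \<beta>\<close> from \<open>W \<beta>\<close> to \<open>W \<alpha>\<close>, where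
  \<open>\<beta> \<subseteq> \<alpha>\<close>. An interaction decomposition is defined on these data alone; that the two presheaves
  of interest satisfy \<open>injective_presheaf\<close> is proved at the end.
\<close>

definition injective_presheaf ::
  "('k, 'm) ring_scheme \<Rightarrow> 'i set set \<Rightarrow> ('i set \<Rightarrow> ('k, 'v) module) \<Rightarrow>
   ('i set \<Rightarrow> 'i set \<Rightarrow> 'v \<Rightarrow> 'v) \<Rightarrow> bool" where
  "injective_presheaf K A W j \<longleftrightarrow>
     (\<forall>\<alpha>\<in>A. module K (W \<alpha>)) \<and>
     (\<forall>\<alpha>\<in>A. \<forall>\<beta>\<in>A. \<beta> \<subseteq> \<alpha> \<longrightarrow>
        j \<alpha> \<beta> \<in> hom (add_monoid (W \<beta>)) (add_monoid (W \<alpha>)) \<and>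
        (\<forall>c\<in>carrier K. \<forall>x\<in>carrier (W \<beta>). j \<alpha> \<beta> (c \<odot>\<^bsub>W \<beta>\<^esub> x) = c \<odot>\<^bsub>W \<alpha>\<^esub> j \<alpha> \<beta> x) \<and>
        inj_on (j \<alpha> \<beta>) (carrier (W \<beta>))) \<and>
     (\<forall>\<alpha>\<in>A. \<forall>x\<in>carrier (W \<alpha>). j \<alpha> \<alpha> x = x) \<and>
     (\<forall>\<alpha>\<in>A. \<forall>\<beta>\<in>A. \<forall>\<gamma>\<in>A. \<gamma> \<subseteq> \<beta> \<longrightarrow> \<beta> \<subseteq> \<alpha> \<longrightarrow>
        (\<forall>x\<in>carrier (W \<gamma>). j \<alpha> \<beta> (j \<beta> \<gamma> x) = j \<alpha> \<gamma> x))"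

definition internal_direct_sum ::
  "('k, 'm) ring_scheme \<Rightarrow> ('k, 'v) module \<Rightarrow> 'b set \<Rightarrow> ('b \<Rightarrow> 'v set) \<Rightarrow> bool" where
  "internal_direct_sum K M B U \<longleftrightarrow>
     finite B \<and> (\<forall>b\<in>B. submodule (U b) K M) \<and>
     (\<forall>x\<in>carrier M. \<exists>!u. u \<in> (\<Pi>\<^sub>E b\<in>B. U b) \<and> (\<Oplus>\<^bsub>M\<^esub>b\<in>B. u b) = x)"

text \<open>
  The index set of the direct sum is automatically finite when \<open>A\<close> is a hypergraph, as each
  \<open>\<alpha> \<in> A\<close> is finite.
\<close>

definition interaction_decomposition ::
  "('k, 'm) ring_scheme \<Rightarrow> 'i set set \<Rightarrow> ('i set \<Rightarrow> ('k, 'v) module) \<Rightarrow>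
   ('i set \<Rightarrow> 'i set \<Rightarrow> 'v \<Rightarrow> 'v) \<Rightarrow> ('i set \<Rightarrow> 'v set) \<Rightarrow> bool" where
  "interaction_decomposition K A W j S \<longleftrightarrow>
     (\<forall>\<gamma>\<in>A. submodule (S \<gamma>) K (W \<gamma>)) \<and>
     (\<forall>\<alpha>\<in>A. internal_direct_sum K (W \<alpha>) {\<beta>\<in>A. \<beta> \<subseteq> \<alpha>} (\<lambda>\<beta>. j \<alpha> \<beta> ` S \<beta>))"


section \<open>Product functors and their free presheaves\<close>

text \<open>
  The sets \<open>E i\<close> live in one ambient type, and the values of \<open>E\<close> outside the vertex set are
  irrelevant. The product over \<open>\<alpha> = {}\<close> is a singleton.
\<close>

definition product_obj :: "('i \<Rightarrow> 'e set) \<Rightarrow> 'i set \<Rightarrow> ('i \<Rightarrow> 'e) set" where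
  "product_obj E \<alpha> = Pi\<^sub>E \<alpha> E"

definition product_proj :: "'i set \<Rightarrow> ('i \<Rightarrow> 'e) \<Rightarrow> ('i \<Rightarrow> 'e)" where
  "product_proj \<beta> x = restrict x \<beta>"

definition function_space :: "('k, 'm) ring_scheme \<Rightarrow> 'x set \<Rightarrow> ('k, 'x \<Rightarrow> 'k) module" where
  "function_space K X =
     \<lparr>carrier = (\<Pi>\<^sub>E x\<in>X. carrier K), mult = undefined, one = undefined,
      zero = (\<lambda>x\<in>X. \<zero>\<^bsub>K\<^esub>), add = (\<lambda>f g. \<lambda>x\<in>X. f x \<oplus>\<^bsub>K\<^esub> g x),
      smult = (\<lambda>c f. \<lambda>x\<in>X. c \<otimes>\<^bsub>K\<^esub> f x)\<rparr>"

definition constant_functions :: "('k, 'm) ring_scheme \<Rightarrow> 'x set \<Rightarrow> ('x \<Rightarrow> 'k) set" where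
  "constant_functions K X = (\<lambda>c. \<lambda>x\<in>X. c) ` carrier K"

definition free_presheaf ::
  "('k, 'm) ring_scheme \<Rightarrow> ('i \<Rightarrow> 'e set) \<Rightarrow> 'i set \<Rightarrow> ('k, ('i \<Rightarrow> 'e) \<Rightarrow> 'k) module" where
  "free_presheaf K E \<alpha> = function_space K (product_obj E \<alpha>)"

definition free_presheaf_map ::
  "('i \<Rightarrow> 'e set) \<Rightarrow> 'i set \<Rightarrow> 'i set \<Rightarrow> (('i \<Rightarrow> 'e) \<Rightarrow> 'k) \<Rightarrow> (('i \<Rightarrow> 'e) \<Rightarrow> 'k)" where
  "free_presheaf_map E \<alpha> \<beta> f = (\<lambda>x\<in>product_obj E \<alpha>. f (product_proj \<beta> x))"

text \<open>
  As in \<^const>\<open>FactRing\<close>, elements of a quotient are cosets, and an operation on cosets is the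
  union, over all representatives, of the cosets of the results.
\<close>

definition quotient_module ::
  "('k, 'v, 'm) module_scheme \<Rightarrow> 'v set \<Rightarrow> ('k, 'v set) module" where
  "quotient_module M N =
     \<lparr>carrier = a_rcosets\<^bsub>M\<^esub> N, mult = undefined, one = undefined,
      zero = N, add = set_add M,
      smult = (\<lambda>c X. \<Union>x\<in>X. N +>\<^bsub>M\<^esub> (c \<odot>\<^bsub>M\<^esub> x))\<rparr>"

definition quotient_map ::
  "('k, 'v, 'm) module_scheme \<Rightarrow> 'v set \<Rightarrow> ('w \<Rightarrow> 'v) \<Rightarrow> 'w set \<Rightarrow> 'v set" where
  "quotient_map M N f X = (\<Union>x\<in>X. N +>\<^bsub>M\<^esub> f x)"

definition reduced_free_presheaf ::
  "('k, 'm) ring_scheme \<Rightarrow> ('i \<Rightarrow> 'e set) \<Rightarrow> 'i set \<Rightarrow> ('k, (('i \<Rightarrow> 'e) \<Rightarrow> 'k) set) module" where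
  "reduced_free_presheaf K E \<alpha> =
     quotient_module (free_presheaf K E \<alpha>) (constant_functions K (product_obj E \<alpha>))"

definition reduced_free_presheaf_map ::
  "('k, 'm) ring_scheme \<Rightarrow> ('i \<Rightarrow> 'e set) \<Rightarrow> 'i set \<Rightarrow> 'i set \<Rightarrow>
   (('i \<Rightarrow> 'e) \<Rightarrow> 'k) set \<Rightarrow> (('i \<Rightarrow> 'e) \<Rightarrow> 'k) set" where
  "reduced_free_presheaf_map K E \<alpha> \<beta> =
     quotient_map (free_presheaf K E \<alpha>) (constant_functions K (product_obj E \<alpha>))
       (free_presheaf_map E \<alpha> \<beta>)"


section \<open>Both are presheaves with injective maps\<close>

lemma product_proj_in: "\<beta> \<subseteq> \<alpha> \<Longrightarrow> x \<in> product_obj E \<alpha> \<Longrightarrow> product_proj \<beta> x \<in> product_obj E \<beta>"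
  by (auto simp: product_obj_def product_proj_def)

lemma product_proj_surj:
  assumes "\<And>i. i \<in> \<alpha> \<Longrightarrow> E i \<noteq> {}" "\<beta> \<subseteq> \<alpha>" "y \<in> product_obj E \<beta>"
  obtains x where "x \<in> product_obj E \<alpha>" "product_proj \<beta> x = y"
proof -
  define x where "x = (\<lambda>i\<in>\<alpha>. if i \<in> \<beta> then y i else (SOME e. e \<in> E i))"
  have "x \<in> product_obj E \<alpha>"
    using assms by (auto simp: x_def product_obj_def PiE_iff some_in_eq)
  moreover have "product_proj \<beta> x = y"
    using assms by (auto simp: x_def product_obj_def product_proj_def PiE_iff extensional_def fun_eq_iff)
  ultimately show ?thesis using that by blast
qed

lemma product_obj_nonempty:
  "(\<And>i. i \<in> \<alpha> \<Longrightarrow> E i \<noteq> {}) \<Longrightarrow> product_obj E \<alpha> \<noteq> {}"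
  by (auto simp: product_obj_def PiE_eq_empty_iff)

lemma function_space_module:
  assumes "cring K"
  shows "module K (function_space K X)"
proof -
  interpret cring K by fact
  show ?thesis
  proof (rule moduleI)
    show "abelian_group (function_space K X)"
    proof (rule abelian_groupI)
      fix f assume f: "f \<in> carrier (function_space K X)"
      show "\<exists>y\<in>carrier (function_space K X).
              y \<oplus>\<^bsub>function_space K X\<^esub> f = \<zero>\<^bsub>function_space K X\<^esub>"
        using f by (intro bexI[of _ "\<lambda>x\<in>X. \<ominus>\<^bsub>K\<^esub> f x"])
          (auto simp: function_space_def PiE_iff fun_eq_iff l_neg)
    qed (auto simp: function_space_def restrict_def PiE_iff fun_eq_iff a_assoc extensional_def
           intro!: a_comm)
  qed (auto simp: assms function_space_def restrict_def PiE_iff fun_eq_iff l_distr r_distr m_assoc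
         extensional_def)
qed

lemma constant_functions_submodule:
  assumes "cring K"
  shows "submodule (constant_functions K X) K (function_space K X)"
proof -
  interpret cring K by fact
  interpret F: module K "function_space K X"
    using assms by (rule function_space_module)
  have const: "(\<lambda>x\<in>X. c) \<in> constant_functions K X" if "c \<in> carrier K" for c
    using that by (auto simp: constant_functions_def)
  have sub: "constant_functions K X \<subseteq> carrier (function_space K X)"
    by (auto simp: constant_functions_def function_space_def)
  have smult: "a \<odot>\<^bsub>function_space K X\<^esub> f \<in> constant_functions K X"
    if a: "a \<in> carrier K" and f: "f \<in> constant_functions K X" for a f
  proof -
    obtain c where c: "c \<in> carrier K" "f = (\<lambda>x\<in>X. c)"
      using f by (auto simp: constant_functions_def)
    have "a \<odot>\<^bsub>function_space K X\<^esub> f = (\<lambda>x\<in>X. a \<otimes>\<^bsub>K\<^esub> c)"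
      by (auto simp: function_space_def c fun_eq_iff)
    then show ?thesis using const a c by simp
  qed
  show ?thesis
  proof (rule F.submoduleI)
    show "\<zero>\<^bsub>function_space K X\<^esub> \<in> constant_functions K X"
      using const[of "\<zero>\<^bsub>K\<^esub>"] by (simp add: function_space_def)
  next
    fix f assume f: "f \<in> constant_functions K X"
    then have "f \<in> carrier (function_space K X)" using sub by auto
    then have "\<ominus>\<^bsub>function_space K X\<^esub> f = (\<ominus>\<^bsub>K\<^esub> \<one>\<^bsub>K\<^esub>) \<odot>\<^bsub>function_space K X\<^esub> f"
      using F.smult_l_minus[of "\<one>\<^bsub>K\<^esub>" f] by simp
    then show "\<ominus>\<^bsub>function_space K X\<^esub> f \<in> constant_functions K X"
      using smult f by simp
  next
    fix f g assume "f \<in> constant_functions K X" "g \<in> constant_functions K X"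
    then obtain c d where c: "c \<in> carrier K" "f = (\<lambda>x\<in>X. c)" and d: "d \<in> carrier K" "g = (\<lambda>x\<in>X. d)"
      by (auto simp: constant_functions_def)
    have "f \<oplus>\<^bsub>function_space K X\<^esub> g = (\<lambda>x\<in>X. c \<oplus>\<^bsub>K\<^esub> d)"
      by (auto simp: function_space_def c d fun_eq_iff)
    then show "f \<oplus>\<^bsub>function_space K X\<^esub> g \<in> constant_functions K X" using const c d by simp
  qed (use sub smult in auto)
qed

context module
begin

lemma submodule_abelian_subgroup: "submodule N R M \<Longrightarrow> abelian_subgroup N M"
  by (intro abelian_subgroupI3 additive_subgroup.intro abelian_group_axioms)
     (auto simp: submodule_def)

lemma quotient_smult_coset:
  assumes N: "submodule N R M" and c: "c \<in> carrier R" and x: "x \<in> carrier M"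
  shows "c \<odot>\<^bsub>quotient_module M N\<^esub> (N +>\<^bsub>M\<^esub> x) = N +>\<^bsub>M\<^esub> (c \<odot>\<^bsub>M\<^esub> x)"
proof -
  interpret N: abelian_subgroup N M using N by (rule submodule_abelian_subgroup)
  have "N +>\<^bsub>M\<^esub> (c \<odot>\<^bsub>M\<^esub> y) = N +>\<^bsub>M\<^esub> (c \<odot>\<^bsub>M\<^esub> x)" if y: "y \<in> N +>\<^bsub>M\<^esub> x" for y
  proof -
    obtain n where n: "n \<in> N" "y = n \<oplus>\<^bsub>M\<^esub> x" using y by (auto simp: a_r_coset_def')
    then have nM: "n \<in> carrier M" using N.a_Hcarr by auto
    have cn: "c \<odot>\<^bsub>M\<^esub> n \<in> N" using submoduleE(4)[OF N] c n by auto
    have "c \<odot>\<^bsub>M\<^esub> y = c \<odot>\<^bsub>M\<^esub> n \<oplus>\<^bsub>M\<^esub> c \<odot>\<^bsub>M\<^esub> x" using n nM c x by (simp add: smult_r_distr)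
    then have "c \<odot>\<^bsub>M\<^esub> y \<in> N +>\<^bsub>M\<^esub> (c \<odot>\<^bsub>M\<^esub> x)" using cn by (auto simp: a_r_coset_def')
    then show ?thesis using smult_closed[OF c x]
      by (rule N.a_repr_independence'[symmetric])
  qed
  then show ?thesis
    unfolding quotient_module_def module.select_convs using N.a_rcos_self[OF x]
    by (intro UN_constant_eq ballI)
qed

lemma quotient_map_coset:
  assumes N: "submodule N R M" and N': "submodule N' R M'" and M': "module R M'"
    and f: "f \<in> hom (add_monoid M) (add_monoid M')" and fN: "f ` N \<subseteq> N'" and x: "x \<in> carrier M"
  shows "quotient_map M' N' f (N +>\<^bsub>M\<^esub> x) = N' +>\<^bsub>M'\<^esub> f x"
proof -
  interpret N: abelian_subgroup N M using N by (rule submodule_abelian_subgroup)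
  interpret M': module R M' by fact
  interpret N': abelian_subgroup N' M' using N' by (rule M'.submodule_abelian_subgroup)
  have fx: "f x \<in> carrier M'" using f x by (auto simp: hom_def)
  have "N' +>\<^bsub>M'\<^esub> f y = N' +>\<^bsub>M'\<^esub> f x" if y: "y \<in> N +>\<^bsub>M\<^esub> x" for y
  proof -
    obtain n where n: "n \<in> N" "y = n \<oplus>\<^bsub>M\<^esub> x" using y by (auto simp: a_r_coset_def')
    then have nM: "n \<in> carrier M" using N.a_Hcarr by auto
    have "f y = f n \<oplus>\<^bsub>M'\<^esub> f x" using n nM x f by (auto simp: hom_def)
    then have "f y \<in> N' +>\<^bsub>M'\<^esub> f x" using fN n by (auto simp: a_r_coset_def')
    then show ?thesis using fx by (rule N'.a_repr_independence'[symmetric])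
  qed
  then show ?thesis
    unfolding quotient_map_def using N.a_rcos_self[OF x]
    by (intro UN_constant_eq ballI)
qed

lemma quotient_carrierE:
  assumes "X \<in> carrier (quotient_module M N)"
  obtains x where "x \<in> carrier M" "X = N +>\<^bsub>M\<^esub> x"
  using assms by (auto simp: quotient_module_def A_RCOSETS_def')

lemma quotient_carrierI: "x \<in> carrier M \<Longrightarrow> N +>\<^bsub>M\<^esub> x \<in> carrier (quotient_module M N)"
  by (auto simp: quotient_module_def A_RCOSETS_def')

lemma quotient_add_coset:
  assumes N: "submodule N R M" and x: "x \<in> carrier M" and y: "y \<in> carrier M"
  shows "(N +>\<^bsub>M\<^esub> x) \<oplus>\<^bsub>quotient_module M N\<^esub> (N +>\<^bsub>M\<^esub> y) = N +>\<^bsub>M\<^esub> (x \<oplus>\<^bsub>M\<^esub> y)"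
proof -
  interpret N: abelian_subgroup N M using N by (rule submodule_abelian_subgroup)
  show ?thesis using x y by (simp add: quotient_module_def N.a_rcos_sum)
qed

lemma quotient_is_module:
  assumes N: "submodule N R M"
  shows "module R (quotient_module M N)"
proof -
  interpret N: abelian_subgroup N M using N by (rule submodule_abelian_subgroup)
  have zero: "\<zero>\<^bsub>quotient_module M N\<^esub> = N +>\<^bsub>M\<^esub> \<zero>\<^bsub>M\<^esub>"
    using a_coset_add_zero[of N] N.a_subset by (simp add: quotient_module_def)
  have ab: "abelian_group (quotient_module M N)"
  proof (rule abelian_groupI)
    fix Y assume "Y \<in> carrier (quotient_module M N)"
    then obtain y where y: "y \<in> carrier M" "Y = N +>\<^bsub>M\<^esub> y" by (rule quotient_carrierE)
    then show "\<exists>Z\<in>carrier (quotient_module M N). Z \<oplus>\<^bsub>quotient_module M N\<^esub> Y = \<zero>\<^bsub>quotient_module M N\<^esub>"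
      by (intro bexI[of _ "N +>\<^bsub>M\<^esub> (\<ominus>\<^bsub>M\<^esub> y)"])
         (auto simp: quotient_add_coset[OF N] zero M.l_neg intro!: quotient_carrierI)
  qed (auto elim!: quotient_carrierE intro!: quotient_carrierI
        simp: quotient_add_coset[OF N] zero M.a_ac)
  show ?thesis
    by (rule moduleI[OF R.is_cring ab])
       (auto elim!: quotient_carrierE intro!: quotient_carrierI
         simp: quotient_smult_coset[OF N] quotient_add_coset[OF N]
               smult_l_distr smult_r_distr smult_assoc1)
qed

end

lemma free_presheaf_map_hom:
  assumes "cring K" "\<beta> \<subseteq> \<alpha>"
  shows "free_presheaf_map E \<alpha> \<beta> \<in> hom (add_monoid (free_presheaf K E \<beta>)) (add_monoid (free_presheaf K E \<alpha>))"
  using product_proj_in[OF assms(2)]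
  by (auto simp: hom_def free_presheaf_def function_space_def free_presheaf_map_def fun_eq_iff PiE_iff)

lemma free_presheaf_map_smult:
  assumes "\<beta> \<subseteq> \<alpha>"
  shows "free_presheaf_map E \<alpha> \<beta> (c \<odot>\<^bsub>free_presheaf K E \<beta>\<^esub> f) =
         c \<odot>\<^bsub>free_presheaf K E \<alpha>\<^esub> free_presheaf_map E \<alpha> \<beta> f"
  using product_proj_in[OF assms(1)]
  by (auto simp: free_presheaf_def function_space_def free_presheaf_map_def fun_eq_iff)

lemma free_presheaf_map_id:
  assumes "f \<in> carrier (free_presheaf K E \<alpha>)"
  shows "free_presheaf_map E \<alpha> \<alpha> f = f"
  using assms
  by (auto simp: free_presheaf_def function_space_def free_presheaf_map_def fun_eq_iff PiE_iff
      product_proj_def product_obj_def extensional_restrict extensional_def[of "PiE \<alpha> E"])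

lemma free_presheaf_map_comp:
  assumes "\<gamma> \<subseteq> \<beta>" "\<beta> \<subseteq> \<alpha>"
  shows "free_presheaf_map E \<alpha> \<beta> (free_presheaf_map E \<beta> \<gamma> f) = free_presheaf_map E \<alpha> \<gamma> f"
  using product_proj_in[OF assms(2)] assms
  by (auto simp: free_presheaf_map_def fun_eq_iff product_proj_def Int_absorb1)

lemma injective_presheaf_free:
  fixes K :: "('k, 'm) ring_scheme"
  assumes K: "field K" and hyp: "hypergraph A I" and E: "\<And>i. i \<in> I \<Longrightarrow> E i \<noteq> {}"
  shows "injective_presheaf K A (free_presheaf K E) (free_presheaf_map E)"
proof -
  interpret field K by fact
  have inj: "inj_on (free_presheaf_map E \<alpha> \<beta>) (carrier (free_presheaf K E \<beta>))"
    if "\<alpha> \<in> A" "\<beta> \<subseteq> \<alpha>" for \<alpha> \<beta>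
  proof (rule inj_onI)
    fix f g assume f: "f \<in> carrier (free_presheaf K E \<beta>)" and g: "g \<in> carrier (free_presheaf K E \<beta>)"
      and eq: "free_presheaf_map E \<alpha> \<beta> f = free_presheaf_map E \<alpha> \<beta> g"
    have "f y = g y" if y: "y \<in> product_obj E \<beta>" for y
    proof -
      have "E i \<noteq> {}" if "i \<in> \<alpha>" for i
        using that E hyp \<open>\<alpha> \<in> A\<close> by (auto simp: hypergraph_def)
      then obtain x where x: "x \<in> product_obj E \<alpha>" "product_proj \<beta> x = y"
        using product_proj_surj[of \<alpha> E \<beta> y] \<open>\<beta> \<subseteq> \<alpha>\<close> y by blast
      then show ?thesis using fun_cong[OF eq, of x] by (simp add: free_presheaf_map_def)
    qed
    then show "f = g"
      using f g by (auto simp: free_presheaf_def function_space_def intro: PiE_ext)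
  qed
  show ?thesis
    unfolding injective_presheaf_def
    using function_space_module[OF is_cring] free_presheaf_map_hom[OF is_cring]
    by (auto simp: inj free_presheaf_map_smult free_presheaf_map_comp)
       (auto simp: free_presheaf_map_id free_presheaf_def)
qed

lemma injective_presheaf_reduced_free:
  fixes K :: "('k, 'm) ring_scheme"
  assumes K: "field K" and hyp: "hypergraph A I" and E: "\<And>i. i \<in> I \<Longrightarrow> E i \<noteq> {}"
  shows "injective_presheaf K A (reduced_free_presheaf K E) (reduced_free_presheaf_map K E)"
proof -
  interpret field K by fact
  let ?V = "free_presheaf K E" and ?C = "\<lambda>\<alpha>. constant_functions K (product_obj E \<alpha>)"
  let ?j = "free_presheaf_map E" and ?W = "reduced_free_presheaf K E"
  let ?jr = "reduced_free_presheaf_map K E"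
  have V: "module K (?V \<alpha>)" for \<alpha>
    unfolding free_presheaf_def by (rule function_space_module[OF is_cring])
  have C: "submodule (?C \<alpha>) K (?V \<alpha>)" for \<alpha>
    unfolding free_presheaf_def by (rule constant_functions_submodule[OF is_cring])
  have W: "module K (?W \<alpha>)" for \<alpha>
    unfolding reduced_free_presheaf_def by (rule module.quotient_is_module[OF V C])
  have jcl: "?j \<alpha> \<beta> f \<in> carrier (?V \<alpha>)" if "\<beta> \<subseteq> \<alpha>" "f \<in> carrier (?V \<beta>)" for \<alpha> \<beta> f
    using free_presheaf_map_hom[OF is_cring that(1), of E] that(2) by (auto simp: hom_def)
  have jC: "?j \<alpha> \<beta> (\<lambda>x\<in>product_obj E \<beta>. c) = (\<lambda>x\<in>product_obj E \<alpha>. c)" if "\<beta> \<subseteq> \<alpha>" for \<alpha> \<beta> and c :: 'k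
    using product_proj_in[OF that] by (auto simp: free_presheaf_map_def fun_eq_iff)
  have coset: "?jr \<alpha> \<beta> (?C \<beta> +>\<^bsub>?V \<beta>\<^esub> f) = ?C \<alpha> +>\<^bsub>?V \<alpha>\<^esub> ?j \<alpha> \<beta> f"
    if "\<beta> \<subseteq> \<alpha>" "f \<in> carrier (?V \<beta>)" for \<alpha> \<beta> f
    unfolding reduced_free_presheaf_map_def
    by (rule module.quotient_map_coset[OF V C C V free_presheaf_map_hom[OF is_cring]])
       (use that jC in \<open>auto simp: constant_functions_def\<close>)
  have carrE: "\<exists>f\<in>carrier (?V \<alpha>). X = ?C \<alpha> +>\<^bsub>?V \<alpha>\<^esub> f" if "X \<in> carrier (?W \<alpha>)" for X \<alpha>
    using that module.quotient_carrierE[OF V] unfolding reduced_free_presheaf_def by metis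
  have carrI: "?C \<alpha> +>\<^bsub>?V \<alpha>\<^esub> f \<in> carrier (?W \<alpha>)" if "f \<in> carrier (?V \<alpha>)" for f \<alpha>
    using that module.quotient_carrierI[OF V] unfolding reduced_free_presheaf_def by metis
  have add: "(?C \<alpha> +>\<^bsub>?V \<alpha>\<^esub> f) \<oplus>\<^bsub>?W \<alpha>\<^esub> (?C \<alpha> +>\<^bsub>?V \<alpha>\<^esub> g) = ?C \<alpha> +>\<^bsub>?V \<alpha>\<^esub> (f \<oplus>\<^bsub>?V \<alpha>\<^esub> g)"
    if "f \<in> carrier (?V \<alpha>)" "g \<in> carrier (?V \<alpha>)" for f g \<alpha>
    using module.quotient_add_coset[OF V C that] unfolding reduced_free_presheaf_def .
  have sm: "c \<odot>\<^bsub>?W \<alpha>\<^esub> (?C \<alpha> +>\<^bsub>?V \<alpha>\<^esub> f) = ?C \<alpha> +>\<^bsub>?V \<alpha>\<^esub> (c \<odot>\<^bsub>?V \<alpha>\<^esub> f)"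
    if "c \<in> carrier K" "f \<in> carrier (?V \<alpha>)" for c f \<alpha>
    using module.quotient_smult_coset[OF V C that] unfolding reduced_free_presheaf_def .
  have Vadd: "f \<oplus>\<^bsub>?V \<alpha>\<^esub> g \<in> carrier (?V \<alpha>)" if "f \<in> carrier (?V \<alpha>)" "g \<in> carrier (?V \<alpha>)" for f g \<alpha>
    using that V[of \<alpha>] by (metis module_def abelian_group_def abelian_monoid.a_closed)
  have Vsm: "c \<odot>\<^bsub>?V \<alpha>\<^esub> f \<in> carrier (?V \<alpha>)" if "c \<in> carrier K" "f \<in> carrier (?V \<alpha>)" for c f \<alpha>
    using that module.smult_closed[OF V] by blast
  have jadd: "?j \<alpha> \<beta> (f \<oplus>\<^bsub>?V \<beta>\<^esub> g) = ?j \<alpha> \<beta> f \<oplus>\<^bsub>?V \<alpha>\<^esub> ?j \<alpha> \<beta> g"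
    if "\<beta> \<subseteq> \<alpha>" "f \<in> carrier (?V \<beta>)" "g \<in> carrier (?V \<beta>)" for \<alpha> \<beta> f g
    using free_presheaf_map_hom[OF is_cring that(1), of E] that(2,3) by (auto simp: hom_def)
  have hom: "?jr \<alpha> \<beta> \<in> hom (add_monoid (?W \<beta>)) (add_monoid (?W \<alpha>))" if "\<beta> \<subseteq> \<alpha>" for \<alpha> \<beta>
  proof (rule homI)
    fix X assume "X \<in> carrier (add_monoid (?W \<beta>))"
    then obtain f where "f \<in> carrier (?V \<beta>)" "X = ?C \<beta> +>\<^bsub>?V \<beta>\<^esub> f"
      using carrE[of X \<beta>] by auto
    then show "?jr \<alpha> \<beta> X \<in> carrier (add_monoid (?W \<alpha>))"
      using that by (simp add: coset carrI jcl)
  next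
    fix X Y assume "X \<in> carrier (add_monoid (?W \<beta>))" "Y \<in> carrier (add_monoid (?W \<beta>))"
    then obtain f g where "f \<in> carrier (?V \<beta>)" "X = ?C \<beta> +>\<^bsub>?V \<beta>\<^esub> f"
      "g \<in> carrier (?V \<beta>)" "Y = ?C \<beta> +>\<^bsub>?V \<beta>\<^esub> g"
      using carrE by (metis partial_object.select_convs(1))
    then show "?jr \<alpha> \<beta> (X \<otimes>\<^bsub>add_monoid (?W \<beta>)\<^esub> Y) = ?jr \<alpha> \<beta> X \<otimes>\<^bsub>add_monoid (?W \<alpha>)\<^esub> ?jr \<alpha> \<beta> Y"
      using that by (simp add: coset add jcl Vadd jadd)
  qed
  have smc: "?jr \<alpha> \<beta> (c \<odot>\<^bsub>?W \<beta>\<^esub> X) = c \<odot>\<^bsub>?W \<alpha>\<^esub> ?jr \<alpha> \<beta> X"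
    if "\<beta> \<subseteq> \<alpha>" "c \<in> carrier K" and X: "X \<in> carrier (?W \<beta>)" for \<alpha> \<beta> c X
  proof -
    obtain f where "f \<in> carrier (?V \<beta>)" "X = ?C \<beta> +>\<^bsub>?V \<beta>\<^esub> f" using carrE[OF X] by auto
    then show ?thesis using that by (simp add: coset sm jcl Vsm free_presheaf_map_smult)
  qed
  have inj: "inj_on (?jr \<alpha> \<beta>) (carrier (?W \<beta>))" if \<alpha>: "\<alpha> \<in> A" and "\<beta> \<in> A" and \<beta>: "\<beta> \<subseteq> \<alpha>" for \<alpha> \<beta>
  proof (rule inj_onI)
    fix X Y assume XY: "X \<in> carrier (?W \<beta>)" "Y \<in> carrier (?W \<beta>)" and eq: "?jr \<alpha> \<beta> X = ?jr \<alpha> \<beta> Y"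
    obtain f g where f: "f \<in> carrier (?V \<beta>)" "X = ?C \<beta> +>\<^bsub>?V \<beta>\<^esub> f"
      and g: "g \<in> carrier (?V \<beta>)" "Y = ?C \<beta> +>\<^bsub>?V \<beta>\<^esub> g" using carrE XY by metis
    interpret C\<alpha>: abelian_subgroup "?C \<alpha>" "?V \<alpha>" by (rule module.submodule_abelian_subgroup[OF V C])
    interpret C\<beta>: abelian_subgroup "?C \<beta>" "?V \<beta>" by (rule module.submodule_abelian_subgroup[OF V C])
    have "?C \<alpha> +>\<^bsub>?V \<alpha>\<^esub> ?j \<alpha> \<beta> f = ?C \<alpha> +>\<^bsub>?V \<alpha>\<^esub> ?j \<alpha> \<beta> g"
      using eq f g \<beta> by (simp add: coset)
    then have "?j \<alpha> \<beta> f \<in> ?C \<alpha> +>\<^bsub>?V \<alpha>\<^esub> ?j \<alpha> \<beta> g"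
      using C\<alpha>.a_rcos_self[OF jcl[OF \<beta> f(1)]] by simp
    then obtain c where c: "c \<in> carrier K"
      and "?j \<alpha> \<beta> f = (\<lambda>x\<in>product_obj E \<alpha>. c) \<oplus>\<^bsub>?V \<alpha>\<^esub> ?j \<alpha> \<beta> g"
      by (auto simp: a_r_coset_def' constant_functions_def)
    moreover have cc: "(\<lambda>x\<in>product_obj E \<beta>. c) \<in> carrier (?V \<beta>)"
      using c by (auto simp: free_presheaf_def function_space_def)
    ultimately have "?j \<alpha> \<beta> f = ?j \<alpha> \<beta> ((\<lambda>x\<in>product_obj E \<beta>. c) \<oplus>\<^bsub>?V \<beta>\<^esub> g)"
      using \<beta> g by (simp add: jadd jC)
    then have "f = (\<lambda>x\<in>product_obj E \<beta>. c) \<oplus>\<^bsub>?V \<beta>\<^esub> g"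
      using injective_presheaf_free[OF K hyp E] that f(1) Vadd[OF cc g(1)]
      by (simp add: injective_presheaf_def inj_on_def)
    then have "f \<in> ?C \<beta> +>\<^bsub>?V \<beta>\<^esub> g"
      using c by (auto simp: a_r_coset_def' constant_functions_def)
    then have "?C \<beta> +>\<^bsub>?V \<beta>\<^esub> g = ?C \<beta> +>\<^bsub>?V \<beta>\<^esub> f"
      using g(1) by (rule C\<beta>.a_repr_independence')
    then show "X = Y" using f g by simp
  qed
  have id: "?jr \<alpha> \<alpha> X = X" if X: "X \<in> carrier (?W \<alpha>)" for \<alpha> X
  proof -
    obtain f where f: "f \<in> carrier (?V \<alpha>)" "X = ?C \<alpha> +>\<^bsub>?V \<alpha>\<^esub> f" using carrE[OF X] by auto
    then show ?thesis by (simp add: coset free_presheaf_map_id[OF f(1)])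
  qed
  have comp: "?jr \<alpha> \<beta> (?jr \<beta> \<gamma> X) = ?jr \<alpha> \<gamma> X"
    if "\<gamma> \<subseteq> \<beta>" "\<beta> \<subseteq> \<alpha>" and X: "X \<in> carrier (?W \<gamma>)" for \<alpha> \<beta> \<gamma> X
  proof -
    obtain f where f: "f \<in> carrier (?V \<gamma>)" "X = ?C \<gamma> +>\<^bsub>?V \<gamma>\<^esub> f" using carrE[OF X] by auto
    have "\<gamma> \<subseteq> \<alpha>" using that by auto
    then show ?thesis using f that by (simp add: coset jcl free_presheaf_map_comp)
  qed
  show ?thesis
    unfolding injective_presheaf_def
    by (intro conjI ballI impI) (rule W hom smc inj id comp; assumption)+
qed

end

theory Submission
  imports Defs
begin

text \<open>
  Fixing a base point \<open>b i\<close> in each \<open>E i\<close> and filling in missing coordinates with it gives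
  retractions \<open>r \<beta> \<alpha>\<close> of the inclusions \<open>j \<alpha> \<beta>\<close> with
  \<open>r \<beta> \<alpha> \<circ> j \<alpha> \<gamma> = j \<beta> (\<beta> \<inter> \<gamma>) \<circ> r (\<beta> \<inter> \<gamma>) \<gamma>\<close>. When \<open>A\<close> is closed under intersections, this identity
  makes the elements of \<open>W \<gamma>\<close> killed by all \<open>r \<beta> \<gamma>\<close> with \<open>\<beta> \<subset> \<gamma>\<close> an interaction
  decomposition. The retractions preserve constants and so descend to the reduced presheaf. Under
  the weak intersection property \<open>insert {} A\<close> is closed under intersections, and since the
  reduced space at \<open>{}\<close> is zero, the summand at \<open>{}\<close> can be dropped again.
\<close>

section \<open>Linear maps\<close>

text \<open>Linearity is asked on the carriers only, in the form used by
  \<open>injective_presheaf\<close>, so that presheaf maps and retractions fit directly.\<close>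

locale linear_map = M: module K M + N: module K N
  for K :: "('k, 'm) ring_scheme" and M :: "('k, 'v) module" and N :: "('k, 'w) module" +
  fixes f :: "'v \<Rightarrow> 'w"
  assumes hom: "f \<in> hom (add_monoid M) (add_monoid N)"
    and smult: "c \<in> carrier K \<Longrightarrow> x \<in> carrier M \<Longrightarrow> f (c \<odot>\<^bsub>M\<^esub> x) = c \<odot>\<^bsub>N\<^esub> f x"
begin

lemma closed [simp]: "x \<in> carrier M \<Longrightarrow> f x \<in> carrier N"
  using hom by (auto simp: hom_def)

lemma add: "x \<in> carrier M \<Longrightarrow> y \<in> carrier M \<Longrightarrow> f (x \<oplus>\<^bsub>M\<^esub> y) = f x \<oplus>\<^bsub>N\<^esub> f y"
  using hom by (auto simp: hom_def)

lemma zero [simp]: "f \<zero>\<^bsub>M\<^esub> = \<zero>\<^bsub>N\<^esub>"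
  using add[of "\<zero>\<^bsub>M\<^esub>" "\<zero>\<^bsub>M\<^esub>"] by simp

lemma uminus: "x \<in> carrier M \<Longrightarrow> f (\<ominus>\<^bsub>M\<^esub> x) = \<ominus>\<^bsub>N\<^esub> f x"
  using add[of "\<ominus>\<^bsub>M\<^esub> x" x] by (simp add: M.M.l_neg N.M.minus_equality)

lemma diff: "x \<in> carrier M \<Longrightarrow> y \<in> carrier M \<Longrightarrow> f (x \<ominus>\<^bsub>M\<^esub> y) = f x \<ominus>\<^bsub>N\<^esub> f y"
  by (simp add: M.M.minus_eq N.M.minus_eq add uminus)

lemma finsum:
  "finite B \<Longrightarrow> u \<in> B \<rightarrow> carrier M \<Longrightarrow> f (\<Oplus>\<^bsub>M\<^esub>b\<in>B. u b) = (\<Oplus>\<^bsub>N\<^esub>b\<in>B. f (u b))"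
  by (induction B rule: finite_induct) (auto simp: add Pi_iff)

text \<open>Needed because the direct summands of \<open>W \<alpha>\<close> are the images of the
  spaces \<open>S \<beta>\<close> under \<open>j \<alpha> \<beta>\<close>.\<close>

lemma image_submodule:
  assumes "submodule S K M"
  shows "submodule (f ` S) K N"
proof (rule N.submoduleI)
  show "\<zero>\<^bsub>N\<^esub> \<in> f ` S"
    using submodule.axioms(1)[OF assms, THEN subgroup.one_closed]
    by (metis zero image_eqI monoid.select_convs(2))
qed (use M.submoduleE[OF assms] in \<open>auto simp: add[symmetric] uminus[symmetric] smult[symmetric] subset_iff\<close>)

end

section \<open>Split presheaves\<close>

text \<open>The maps \<open>r \<beta> \<alpha>\<close> run opposite to
  \<open>j \<alpha> \<beta>\<close>. Taking \<gamma> = \<beta> in \<open>r_j\<close> and using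
  \<open>r_id\<close> shows that \<open>r \<beta> \<alpha>\<close> is a left inverse of
  \<open>j \<alpha> \<beta>\<close>; for general \<gamma>, \<open>r_j\<close> is a base change
  condition for the square formed by \<alpha>, \<beta>, \<gamma> and \<beta> \<inter>
  \<gamma>.\<close>

locale split_presheaf =
  fixes K :: "('k, 'm) ring_scheme" and A :: "'i set set"
    and W :: "'i set \<Rightarrow> ('k, 'v) module"
    and j r :: "'i set \<Rightarrow> 'i set \<Rightarrow> 'v \<Rightarrow> 'v"
  assumes presheaf: "injective_presheaf K A W j"
    and finite: "\<alpha> \<in> A \<Longrightarrow> finite \<alpha>"
    and Int_mem: "\<alpha> \<in> A \<Longrightarrow> \<beta> \<in> A \<Longrightarrow> \<alpha> \<inter> \<beta> \<in> A"
    and r_linear: "\<alpha> \<in> A \<Longrightarrow> \<beta> \<in> A \<Longrightarrow> \<beta> \<subseteq> \<alpha> \<Longrightarrow> linear_map K (W \<alpha>) (W \<beta>) (r \<beta> \<alpha>)"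
    and r_id: "\<alpha> \<in> A \<Longrightarrow> x \<in> carrier (W \<alpha>) \<Longrightarrow> r \<alpha> \<alpha> x = x"
    and r_comp: "\<alpha> \<in> A \<Longrightarrow> \<beta> \<in> A \<Longrightarrow> \<gamma> \<in> A \<Longrightarrow> \<gamma> \<subseteq> \<beta> \<Longrightarrow> \<beta> \<subseteq> \<alpha> \<Longrightarrow>
      x \<in> carrier (W \<alpha>) \<Longrightarrow> r \<gamma> \<beta> (r \<beta> \<alpha> x) = r \<gamma> \<alpha> x"
    and r_j: "\<alpha> \<in> A \<Longrightarrow> \<beta> \<in> A \<Longrightarrow> \<gamma> \<in> A \<Longrightarrow> \<beta> \<subseteq> \<alpha> \<Longrightarrow> \<gamma> \<subseteq> \<alpha> \<Longrightarrow>
      x \<in> carrier (W \<gamma>) \<Longrightarrow> r \<beta> \<alpha> (j \<alpha> \<gamma> x) = j \<beta> (\<beta> \<inter> \<gamma>) (r (\<beta> \<inter> \<gamma>) \<gamma> x)"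
begin

text \<open>For the free presheaf on all finite subsets of the vertex set, with the retractions
  constructed below, these are the functions on the product over \<gamma> that vanish wherever some
  coordinate equals its base point.\<close>

definition S :: "'i set \<Rightarrow> 'v set" where
  "S \<gamma> = {v \<in> carrier (W \<gamma>). \<forall>\<beta>\<in>A. \<beta> \<subset> \<gamma> \<longrightarrow> r \<beta> \<gamma> v = \<zero>\<^bsub>W \<beta>\<^esub>}"

definition below :: "'i set \<Rightarrow> 'i set set" where
  "below \<alpha> = {\<beta> \<in> A. \<beta> \<subseteq> \<alpha>}"

text \<open>The components are taken in \<open>S \<beta>\<close> rather than in their images inside
  \<open>W \<alpha>\<close>, so that one family \<open>v\<close> can be read at every set below
  \<alpha>, as in \<open>r_sum\<close>.\<close>

definition decomposable :: "'i set \<Rightarrow> 'v \<Rightarrow> bool" where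
  "decomposable \<alpha> x \<longleftrightarrow> (\<exists>v. (\<forall>\<beta>\<in>below \<alpha>. v \<beta> \<in> S \<beta>) \<and> x = (\<Oplus>\<^bsub>W \<alpha>\<^esub>\<beta>\<in>below \<alpha>. j \<alpha> \<beta> (v \<beta>)))"

section \<open>Structure maps and the spaces of pure components\<close>

lemma module_W: "\<alpha> \<in> A \<Longrightarrow> module K (W \<alpha>)"
  using presheaf by (auto simp: injective_presheaf_def)

lemma j_linear: "\<alpha> \<in> A \<Longrightarrow> \<beta> \<in> A \<Longrightarrow> \<beta> \<subseteq> \<alpha> \<Longrightarrow> linear_map K (W \<beta>) (W \<alpha>) (j \<alpha> \<beta>)"
  using presheaf
  by (auto simp: injective_presheaf_def linear_map_def linear_map_axioms_def)

lemma j_id: "\<alpha> \<in> A \<Longrightarrow> x \<in> carrier (W \<alpha>) \<Longrightarrow> j \<alpha> \<alpha> x = x"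
  using presheaf by (auto simp: injective_presheaf_def)

lemma j_comp: "\<alpha> \<in> A \<Longrightarrow> \<beta> \<in> A \<Longrightarrow> \<gamma> \<in> A \<Longrightarrow> \<gamma> \<subseteq> \<beta> \<Longrightarrow> \<beta> \<subseteq> \<alpha> \<Longrightarrow>
    x \<in> carrier (W \<gamma>) \<Longrightarrow> j \<alpha> \<beta> (j \<beta> \<gamma> x) = j \<alpha> \<gamma> x"
  using presheaf unfolding injective_presheaf_def by blast

lemmas j_closed = linear_map.closed[OF j_linear]
lemmas r_closed = linear_map.closed[OF r_linear]

lemma below_iff: "\<beta> \<in> below \<alpha> \<longleftrightarrow> \<beta> \<in> A \<and> \<beta> \<subseteq> \<alpha>"
  by (simp add: below_def)

lemma finite_below: "\<alpha> \<in> A \<Longrightarrow> Finite_Set.finite (below \<alpha>)"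
  by (rule finite_subset[of _ "Pow \<alpha>"]) (auto simp: below_def finite)

lemma S_carrier: "v \<in> S \<gamma> \<Longrightarrow> v \<in> carrier (W \<gamma>)"
  by (simp add: S_def)

text \<open>An intersection of kernels of linear maps; the auxiliary equations give the closure of
  each kernel under the module operations.\<close>

lemma S_submodule:
  assumes "\<gamma> \<in> A"
  shows "submodule (S \<gamma>) K (W \<gamma>)"
proof -
  interpret W: module K "W \<gamma>" using assms by (rule module_W)
  have linear: "linear_map K (W \<gamma>) (W \<beta>) (r \<beta> \<gamma>)" if "\<beta> \<in> A" "\<beta> \<subset> \<gamma>" for \<beta>
    using that assms by (intro r_linear) auto
  have ab: "abelian_group (W \<beta>)" if "\<beta> \<in> A" for \<beta>
    using module_W[OF that] by (rule module.axioms)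
  have minus_zero: "\<ominus>\<^bsub>W \<beta>\<^esub> \<zero>\<^bsub>W \<beta>\<^esub> = \<zero>\<^bsub>W \<beta>\<^esub>" if "\<beta> \<in> A" for \<beta>
  proof -
    interpret abelian_group "W \<beta>" using that by (rule ab)
    show ?thesis by (intro minus_equality) auto
  qed
  note eqs = linear_map.zero[OF linear] linear_map.uminus[OF linear] linear_map.add[OF linear]
    linear_map.smult[OF linear] module.smult_r_null[OF module_W]
    minus_zero abelian_monoid.l_zero[OF abelian_group.axioms(1)[OF ab]]
    abelian_monoid.zero_closed[OF abelian_group.axioms(1)[OF ab]]
  show ?thesis by (rule W.submoduleI) (auto simp: S_def eqs)
qed

lemma zero_S: "\<gamma> \<in> A \<Longrightarrow> \<zero>\<^bsub>W \<gamma>\<^esub> \<in> S \<gamma>"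
  using S_submodule[THEN submodule.axioms(1), THEN subgroup.one_closed] by simp

lemma add_S: "\<gamma> \<in> A \<Longrightarrow> v \<in> S \<gamma> \<Longrightarrow> w \<in> S \<gamma> \<Longrightarrow> v \<oplus>\<^bsub>W \<gamma>\<^esub> w \<in> S \<gamma>"
  by (rule module.submoduleE(5)[OF module_W S_submodule])

lemma j_S_closed: "\<alpha> \<in> A \<Longrightarrow> \<beta> \<in> below \<alpha> \<Longrightarrow> v \<in> S \<beta> \<Longrightarrow> j \<alpha> \<beta> v \<in> carrier (W \<alpha>)"
  by (auto simp: below_iff intro: j_closed S_carrier)

section \<open>Retracting sums of components; uniqueness of the components\<close>

text \<open>By \<open>r_j\<close> the retraction acts on \<open>v\<close> as
  \<open>r (\<beta> \<inter> \<gamma>) \<gamma>\<close>. Either \<beta> \<inter> \<gamma> = \<gamma>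
  and this is the identity, or \<beta> \<inter> \<gamma> is a proper subset of \<gamma> and the
  definition of \<open>S \<gamma>\<close> makes it vanish. The second case needs \<beta> \<inter>
  \<gamma> in \<open>A\<close>, hence closure under intersections.\<close>

lemma r_j_S:
  assumes "\<alpha> \<in> A" "\<beta> \<in> below \<alpha>" "\<gamma> \<in> below \<alpha>" "v \<in> S \<gamma>"
  shows "r \<beta> \<alpha> (j \<alpha> \<gamma> v) = (if \<gamma> \<subseteq> \<beta> then j \<beta> \<gamma> v else \<zero>\<^bsub>W \<beta>\<^esub>)"
proof -
  have rj: "r \<beta> \<alpha> (j \<alpha> \<gamma> v) = j \<beta> (\<beta> \<inter> \<gamma>) (r (\<beta> \<inter> \<gamma>) \<gamma> v)"
    using assms by (auto simp: below_iff intro!: r_j S_carrier)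
  show ?thesis
  proof (cases "\<gamma> \<subseteq> \<beta>")
    case True
    then show ?thesis using rj assms by (simp add: Int_absorb1 r_id S_carrier below_iff)
  next
    case False
    then have "\<beta> \<inter> \<gamma> \<in> A" "\<beta> \<inter> \<gamma> \<subset> \<gamma>" using assms by (auto simp: below_iff intro: Int_mem)
    then have "r (\<beta> \<inter> \<gamma>) \<gamma> v = \<zero>\<^bsub>W (\<beta> \<inter> \<gamma>)\<^esub>" using assms(4) by (simp add: S_def)
    then show ?thesis
      using rj False assms linear_map.zero[OF j_linear[of \<beta> "\<beta> \<inter> \<gamma>"]] Int_mem
      by (simp add: below_iff)
  qed
qed

text \<open>By \<open>r_j_S\<close> the terms below \<beta> survive and all others vanish, so a
  decomposition at \<alpha> restricts to one at \<beta> with the same components.\<close>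

lemma r_sum:
  assumes "\<alpha> \<in> A" "\<beta> \<in> below \<alpha>" and v: "\<And>\<gamma>. \<gamma> \<in> below \<alpha> \<Longrightarrow> v \<gamma> \<in> S \<gamma>"
  shows "r \<beta> \<alpha> (\<Oplus>\<^bsub>W \<alpha>\<^esub>\<gamma>\<in>below \<alpha>. j \<alpha> \<gamma> (v \<gamma>)) = (\<Oplus>\<^bsub>W \<beta>\<^esub>\<gamma>\<in>below \<beta>. j \<beta> \<gamma> (v \<gamma>))"
proof -
  have \<beta>: "\<beta> \<in> A" "\<beta> \<subseteq> \<alpha>" using assms by (auto simp: below_iff)
  interpret linear_map K "W \<alpha>" "W \<beta>" "r \<beta> \<alpha>" using \<beta> assms(1) by (intro r_linear)
  have "r \<beta> \<alpha> (\<Oplus>\<^bsub>W \<alpha>\<^esub>\<gamma>\<in>below \<alpha>. j \<alpha> \<gamma> (v \<gamma>)) = (\<Oplus>\<^bsub>W \<beta>\<^esub>\<gamma>\<in>below \<alpha>. r \<beta> \<alpha> (j \<alpha> \<gamma> (v \<gamma>)))"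
    using assms by (intro finsum finite_below) (auto intro: j_S_closed)
  also have "\<dots> = (\<Oplus>\<^bsub>W \<beta>\<^esub>\<gamma>\<in>below \<beta>. j \<beta> \<gamma> (v \<gamma>))"
  proof (rule N.M.add.finprod_mono_neutral_cong_right)
    show "Finite_Set.finite (below \<alpha>)" "below \<beta> \<subseteq> below \<alpha>"
      using assms(1) \<beta> finite_below by (auto simp: below_def)
    show "(\<lambda>\<gamma>. r \<beta> \<alpha> (j \<alpha> \<gamma> (v \<gamma>))) \<in> below \<alpha> \<rightarrow> carrier (W \<beta>)"
      using assms(1) v by (auto intro!: closed j_S_closed)
  next
    fix \<gamma> assume \<gamma>: "\<gamma> \<in> below \<beta>"
    then have "\<gamma> \<in> below \<alpha>" using \<beta> by (auto simp: below_iff)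
    then show "r \<beta> \<alpha> (j \<alpha> \<gamma> (v \<gamma>)) = j \<beta> \<gamma> (v \<gamma>)"
      using assms \<gamma> by (simp add: r_j_S below_iff)
  qed (use assms in \<open>simp add: r_j_S below_iff\<close>)
  finally show ?thesis .
qed

text \<open>
  Applying \<open>r \<beta> \<alpha>\<close> isolates the components below \<open>\<beta>\<close>, so they are determined by induction on \<open>\<beta>\<close>.
\<close>

lemma components_unique:
  assumes \<alpha>: "\<alpha> \<in> A"
    and v: "\<And>\<gamma>. \<gamma> \<in> below \<alpha> \<Longrightarrow> v \<gamma> \<in> S \<gamma>" and w: "\<And>\<gamma>. \<gamma> \<in> below \<alpha> \<Longrightarrow> w \<gamma> \<in> S \<gamma>"
    and eq: "(\<Oplus>\<^bsub>W \<alpha>\<^esub>\<gamma>\<in>below \<alpha>. j \<alpha> \<gamma> (v \<gamma>)) = (\<Oplus>\<^bsub>W \<alpha>\<^esub>\<gamma>\<in>below \<alpha>. j \<alpha> \<gamma> (w \<gamma>))"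
    and \<beta>: "\<beta> \<in> below \<alpha>"
  shows "v \<beta> = w \<beta>"
proof -
  have "Finite_Set.finite \<beta>" using \<beta> finite by (auto simp: below_iff)
  then show ?thesis using \<beta>
  proof (induction \<beta> rule: finite_psubset_induct)
    case (psubset \<beta>)
    then have \<beta>: "\<beta> \<in> A" "\<beta> \<subseteq> \<alpha>" by (auto simp: below_iff)
    interpret W: module K "W \<beta>" using \<beta>(1) by (rule module_W)
    have sub: "\<gamma> \<in> below \<alpha>" if "\<gamma> \<in> below \<beta>" for \<gamma> using that \<beta> by (auto simp: below_iff)
    have jv: "j \<beta> \<gamma> (v \<gamma>) \<in> carrier (W \<beta>)" and jw: "j \<beta> \<gamma> (w \<gamma>) \<in> carrier (W \<beta>)"
      if "\<gamma> \<in> below \<beta>" for \<gamma>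
      using that sub v w \<beta>(1) by (auto intro!: j_S_closed)
    define B where "B = below \<beta> - {\<beta>}"
    have B: "below \<beta> = insert \<beta> B" "\<beta> \<notin> B" "Finite_Set.finite B"
      using \<beta> finite_below by (auto simp: B_def below_iff)
    have IH: "v \<gamma> = w \<gamma>" if "\<gamma> \<in> B" for \<gamma>
      using that psubset.IH[of \<gamma>] sub[of \<gamma>] by (auto simp: B_def below_iff)
    have "(\<Oplus>\<^bsub>W \<beta>\<^esub>\<gamma>\<in>below \<beta>. j \<beta> \<gamma> (v \<gamma>)) = (\<Oplus>\<^bsub>W \<beta>\<^esub>\<gamma>\<in>below \<beta>. j \<beta> \<gamma> (w \<gamma>))"
      using r_sum[OF \<alpha> psubset.prems, of v] r_sum[OF \<alpha> psubset.prems, of w] v w eq by simp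
    \<comment> \<open>The induction hypothesis identifies the contributions of the proper subsets of
      \<beta>. Both sums thus have the same remainder over \<open>B\<close>, which cancels and
      leaves the top terms, where \<open>j \<beta> \<beta>\<close> is the identity.\<close>
    moreover have "(\<Oplus>\<^bsub>W \<beta>\<^esub>\<gamma>\<in>below \<beta>. j \<beta> \<gamma> (v \<gamma>)) = j \<beta> \<beta> (v \<beta>) \<oplus>\<^bsub>W \<beta>\<^esub> (\<Oplus>\<^bsub>W \<beta>\<^esub>\<gamma>\<in>B. j \<beta> \<gamma> (w \<gamma>))"
    proof -
      have "(\<Oplus>\<^bsub>W \<beta>\<^esub>\<gamma>\<in>B. j \<beta> \<gamma> (v \<gamma>)) = (\<Oplus>\<^bsub>W \<beta>\<^esub>\<gamma>\<in>B. j \<beta> \<gamma> (w \<gamma>))"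
        by (rule W.M.finsum_cong') (use IH jw B in auto)
      then show ?thesis
        using B jv by (simp add: W.M.finsum_insert Pi_iff)
    qed
    moreover have "(\<Oplus>\<^bsub>W \<beta>\<^esub>\<gamma>\<in>below \<beta>. j \<beta> \<gamma> (w \<gamma>)) = j \<beta> \<beta> (w \<beta>) \<oplus>\<^bsub>W \<beta>\<^esub> (\<Oplus>\<^bsub>W \<beta>\<^esub>\<gamma>\<in>B. j \<beta> \<gamma> (w \<gamma>))"
      using B jw by (simp add: W.M.finsum_insert Pi_iff)
    moreover have "(\<Oplus>\<^bsub>W \<beta>\<^esub>\<gamma>\<in>B. j \<beta> \<gamma> (w \<gamma>)) \<in> carrier (W \<beta>)"
      using B jw by (intro W.M.finsum_closed) auto
    ultimately have "j \<beta> \<beta> (v \<beta>) = j \<beta> \<beta> (w \<beta>)"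
      using jv[of \<beta>] jw[of \<beta>] B by simp
    then show "v \<beta> = w \<beta>"
      using \<beta> v[OF psubset.prems] w[OF psubset.prems] by (simp add: j_id S_carrier)
  qed
qed

section \<open>Existence of decompositions\<close>

lemma decomposable_carrier: "\<alpha> \<in> A \<Longrightarrow> decomposable \<alpha> x \<Longrightarrow> x \<in> carrier (W \<alpha>)"
  unfolding decomposable_def
  by (auto intro!: abelian_monoid.finsum_closed j_S_closed abelian_group.axioms(1)
        module.axioms(2) module_W)

lemma decomposable_add:
  assumes \<alpha>: "\<alpha> \<in> A" and "decomposable \<alpha> x" "decomposable \<alpha> y"
  shows "decomposable \<alpha> (x \<oplus>\<^bsub>W \<alpha>\<^esub> y)"
proof -
  interpret W: module K "W \<alpha>" using \<alpha> by (rule module_W)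
  obtain v w where v: "\<And>\<beta>. \<beta> \<in> below \<alpha> \<Longrightarrow> v \<beta> \<in> S \<beta>" "x = (\<Oplus>\<^bsub>W \<alpha>\<^esub>\<beta>\<in>below \<alpha>. j \<alpha> \<beta> (v \<beta>))"
    and w: "\<And>\<beta>. \<beta> \<in> below \<alpha> \<Longrightarrow> w \<beta> \<in> S \<beta>" "y = (\<Oplus>\<^bsub>W \<alpha>\<^esub>\<beta>\<in>below \<alpha>. j \<alpha> \<beta> (w \<beta>))"
    using assms by (auto simp: decomposable_def)
  have "(\<Oplus>\<^bsub>W \<alpha>\<^esub>\<beta>\<in>below \<alpha>. j \<alpha> \<beta> (v \<beta> \<oplus>\<^bsub>W \<beta>\<^esub> w \<beta>)) =
        (\<Oplus>\<^bsub>W \<alpha>\<^esub>\<beta>\<in>below \<alpha>. j \<alpha> \<beta> (v \<beta>) \<oplus>\<^bsub>W \<alpha>\<^esub> j \<alpha> \<beta> (w \<beta>))"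
    using \<alpha> v w
    by (intro W.M.finsum_cong')
       (auto simp: linear_map.add[OF j_linear] below_iff S_carrier intro!: j_S_closed)
  also have "\<dots> = x \<oplus>\<^bsub>W \<alpha>\<^esub> y"
    unfolding v(2) w(2) using \<alpha> v w by (intro W.M.finsum_addf) (auto intro: j_S_closed)
  finally show ?thesis
    unfolding decomposable_def using v w
    by (intro exI[of _ "\<lambda>\<beta>. v \<beta> \<oplus>\<^bsub>W \<beta>\<^esub> w \<beta>"]) (auto intro: add_S simp: below_iff)
qed

text \<open>Functoriality of \<open>j\<close> carries each summand at \<beta> to the summand at
  \<alpha> with the same index. This lets corrections coming from smaller sets be decomposed by
  induction.\<close>

lemma decomposable_j:
  assumes \<alpha>: "\<alpha> \<in> A" and \<beta>: "\<beta> \<in> A" "\<beta> \<subseteq> \<alpha>" and "decomposable \<beta> x"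
  shows "decomposable \<alpha> (j \<alpha> \<beta> x)"
proof -
  interpret linear_map K "W \<beta>" "W \<alpha>" "j \<alpha> \<beta>" using assms by (intro j_linear)
  obtain v where v: "\<And>\<gamma>. \<gamma> \<in> below \<beta> \<Longrightarrow> v \<gamma> \<in> S \<gamma>" "x = (\<Oplus>\<^bsub>W \<beta>\<^esub>\<gamma>\<in>below \<beta>. j \<beta> \<gamma> (v \<gamma>))"
    using assms by (auto simp: decomposable_def)
  have below_mono: "\<gamma> \<in> below \<alpha>" if "\<gamma> \<in> below \<beta>" for \<gamma>
    using that \<beta> by (auto simp: below_iff)
  \<comment> \<open>Extension by zero to the sets below \<alpha> that do not lie below
    \<beta>.\<close>
  define w where "w \<gamma> = (if \<gamma> \<subseteq> \<beta> then v \<gamma> else \<zero>\<^bsub>W \<gamma>\<^esub>)" for \<gamma>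
  have w: "w \<gamma> \<in> S \<gamma>" if "\<gamma> \<in> below \<alpha>" for \<gamma>
    using that v by (auto simp: w_def below_iff zero_S)
  have "j \<alpha> \<beta> x = (\<Oplus>\<^bsub>W \<alpha>\<^esub>\<gamma>\<in>below \<beta>. j \<alpha> \<beta> (j \<beta> \<gamma> (v \<gamma>)))"
    unfolding v(2) using v \<beta> by (intro finsum finite_below) (auto intro: j_S_closed)
  also have "\<dots> = (\<Oplus>\<^bsub>W \<alpha>\<^esub>\<gamma>\<in>below \<alpha>. j \<alpha> \<gamma> (w \<gamma>))"
  proof (rule N.M.add.finprod_mono_neutral_cong_left)
    show "j \<alpha> \<gamma> (w \<gamma>) = \<zero>\<^bsub>W \<alpha>\<^esub>" if "\<gamma> \<in> below \<alpha> - below \<beta>" for \<gamma>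
      using that \<alpha> by (auto simp: below_iff w_def linear_map.zero[OF j_linear])
    show "j \<alpha> \<beta> (j \<beta> \<gamma> (v \<gamma>)) = j \<alpha> \<gamma> (w \<gamma>)" if "\<gamma> \<in> below \<beta>" for \<gamma>
      using that v(1)[OF that] \<alpha> \<beta> by (simp add: j_comp below_iff w_def S_carrier)
    show "(\<lambda>\<gamma>. j \<alpha> \<gamma> (w \<gamma>)) \<in> below \<alpha> \<rightarrow> carrier (W \<alpha>)"
      using w by (auto intro: j_S_closed[OF \<alpha>])
  qed (use \<alpha> below_mono in \<open>auto simp: finite_below\<close>)
  finally show ?thesis unfolding decomposable_def using w by blast
qed

text \<open>The only nonzero component sits at \<alpha> itself, where
  \<open>j \<alpha> \<alpha>\<close> is the identity. Besides the top component, this also covers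
  the zero vector.\<close>

lemma decomposable_S:
  assumes \<alpha>: "\<alpha> \<in> A" and x: "x \<in> S \<alpha>"
  shows "decomposable \<alpha> x"
proof -
  interpret W: module K "W \<alpha>" using \<alpha> by (rule module_W)
  define v where "v \<beta> = (if \<beta> = \<alpha> then x else \<zero>\<^bsub>W \<beta>\<^esub>)" for \<beta>
  have v: "v \<beta> \<in> S \<beta>" if "\<beta> \<in> below \<alpha>" for \<beta>
    using that x by (auto simp: v_def below_iff zero_S)
  have "(\<Oplus>\<^bsub>W \<alpha>\<^esub>\<beta>\<in>below \<alpha>. j \<alpha> \<beta> (v \<beta>)) = (\<Oplus>\<^bsub>W \<alpha>\<^esub>\<beta>\<in>{\<alpha>}. x)"
    by (rule W.M.add.finprod_mono_neutral_cong_right)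
       (use \<alpha> x v in \<open>auto simp: finite_below below_iff v_def j_id S_carrier
          linear_map.zero[OF j_linear] intro!: j_closed W.M.zero_closed\<close>)
  also have "\<dots> = x" using x S_carrier by (simp add: W.M.finsum_insert)
  finally show ?thesis unfolding decomposable_def using v by metis
qed

text \<open>
  The operators \<open>1 - j \<alpha> \<gamma> \<circ> r \<gamma> \<alpha>\<close>, for \<open>\<gamma>\<close> strictly below \<open>\<alpha>\<close>, commute, so composing them kills
  all proper restrictions at the cost of a correction coming from smaller sets.
\<close>

lemma decomposable_all:
  assumes "\<alpha> \<in> A" "x \<in> carrier (W \<alpha>)"
  shows "decomposable \<alpha> x"
  using finite[OF assms(1)] assms
proof (induction \<alpha> arbitrary: x rule: finite_psubset_induct)
  case (psubset \<alpha>)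
  note \<alpha> = \<open>\<alpha> \<in> A\<close>
  interpret W: module K "W \<alpha>" using \<alpha> by (rule module_W)
  \<comment> \<open>The proper subsets are treated one at a time: \<open>y\<close> is what remains
    of \<open>x\<close> once the retractions to the members of \<open>C\<close> have been made to
    vanish, and \<open>d\<close> collects the corrections.\<close>
  have "\<exists>y d. y \<in> carrier (W \<alpha>) \<and> (\<forall>\<beta>\<in>C. r \<beta> \<alpha> y = \<zero>\<^bsub>W \<beta>\<^esub>) \<and> decomposable \<alpha> d \<and> x = y \<oplus>\<^bsub>W \<alpha>\<^esub> d"
    if "Finite_Set.finite C" "C \<subseteq> below \<alpha> - {\<alpha>}" for C
    using that
  proof (induction C rule: finite_induct)
    case empty
    have "decomposable \<alpha> \<zero>\<^bsub>W \<alpha>\<^esub>" using \<alpha> by (intro decomposable_S zero_S)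
    then show ?case using psubset.prems by force
  next
    case (insert \<gamma> C)
    then obtain y d where y: "y \<in> carrier (W \<alpha>)" "\<And>\<beta>. \<beta> \<in> C \<Longrightarrow> r \<beta> \<alpha> y = \<zero>\<^bsub>W \<beta>\<^esub>"
      and d: "decomposable \<alpha> d" "x = y \<oplus>\<^bsub>W \<alpha>\<^esub> d" by auto
    have \<gamma>: "\<gamma> \<in> A" "\<gamma> \<subseteq> \<alpha>" "\<gamma> \<subset> \<alpha>" using insert.prems by (auto simp: below_iff)
    \<comment> \<open>The part of \<open>y\<close> that comes from \<gamma>. It moves from
      \<open>y\<close> to \<open>d\<close>, and is decomposable by the induction hypothesis at
      \<gamma>.\<close>
    define p where "p = j \<alpha> \<gamma> (r \<gamma> \<alpha> y)"
    have ry: "r \<gamma> \<alpha> y \<in> carrier (W \<gamma>)" using \<alpha> \<gamma> y by (auto intro: r_closed)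
    have p: "p \<in> carrier (W \<alpha>)" unfolding p_def using \<alpha> \<gamma> ry by (auto intro: j_closed)
    have pd: "decomposable \<alpha> p"
      unfolding p_def using \<alpha> \<gamma> ry psubset.IH by (intro decomposable_j) auto
    \<comment> \<open>It is enough that \<open>p\<close> and \<open>y\<close> have the same
      retraction to \<beta>. For \<beta> = \<gamma> this is the left inverse property; for \<beta>
      in \<open>C\<close> the retraction of \<open>p\<close> factors through that of
      \<open>y\<close>, which is zero, so the earlier vanishing is not destroyed.\<close>
    have "r \<beta> \<alpha> (y \<ominus>\<^bsub>W \<alpha>\<^esub> p) = \<zero>\<^bsub>W \<beta>\<^esub>" if "\<beta> \<in> insert \<gamma> C" for \<beta>
    proof -
      have "\<beta> \<in> below \<alpha>" using that insert.prems by auto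
      then have \<beta>: "\<beta> \<in> A" "\<beta> \<subseteq> \<alpha>" by (auto simp: below_iff)
      interpret linear_map K "W \<alpha>" "W \<beta>" "r \<beta> \<alpha>" using \<alpha> \<beta> by (intro r_linear)
      have I: "\<beta> \<inter> \<gamma> \<in> A" using \<beta> \<gamma> by (intro Int_mem)
      have "r \<beta> \<alpha> p = j \<beta> (\<beta> \<inter> \<gamma>) (r (\<beta> \<inter> \<gamma>) \<gamma> (r \<gamma> \<alpha> y))"
        unfolding p_def using \<alpha> \<beta> \<gamma> ry by (intro r_j)
      also have "\<dots> = j \<beta> (\<beta> \<inter> \<gamma>) (r (\<beta> \<inter> \<gamma>) \<beta> (r \<beta> \<alpha> y))"
        using \<alpha> \<beta> \<gamma> y I by (simp add: r_comp)
      also have "\<dots> = r \<beta> \<alpha> y"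
      proof (cases "\<beta> = \<gamma>")
        case True
        then show ?thesis using \<gamma> ry by (simp add: r_id j_id)
      next
        case False
        then have "r \<beta> \<alpha> y = \<zero>\<^bsub>W \<beta>\<^esub>" using that y by auto
        then show ?thesis
          using \<beta> I linear_map.zero[OF r_linear[of \<beta> "\<beta> \<inter> \<gamma>"]]
            linear_map.zero[OF j_linear[of \<beta> "\<beta> \<inter> \<gamma>"]] by simp
      qed
      finally show ?thesis using y p by (simp add: diff N.M.minus_eq N.M.r_neg)
    qed
    moreover have "x = (y \<ominus>\<^bsub>W \<alpha>\<^esub> p) \<oplus>\<^bsub>W \<alpha>\<^esub> (p \<oplus>\<^bsub>W \<alpha>\<^esub> d)"
      using y p d decomposable_carrier[OF \<alpha> d(1)]
      by (simp add: W.M.minus_eq W.M.a_assoc W.M.r_neg1)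
    moreover have "decomposable \<alpha> (p \<oplus>\<^bsub>W \<alpha>\<^esub> d)" using \<alpha> pd d by (intro decomposable_add)
    moreover have "y \<ominus>\<^bsub>W \<alpha>\<^esub> p \<in> carrier (W \<alpha>)" using y p by simp
    ultimately show ?case by blast
  qed
  from this[of "below \<alpha> - {\<alpha>}"] obtain y d where
    "y \<in> carrier (W \<alpha>)" "\<And>\<beta>. \<beta> \<in> below \<alpha> - {\<alpha>} \<Longrightarrow> r \<beta> \<alpha> y = \<zero>\<^bsub>W \<beta>\<^esub>"
    "decomposable \<alpha> d" "x = y \<oplus>\<^bsub>W \<alpha>\<^esub> d"
    using finite_below[OF \<alpha>] by blast
  \<comment> \<open>All proper subsets have now been treated, so the remainder \<open>y\<close> is
    the component at \<alpha>.\<close>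
  moreover from this have "y \<in> S \<alpha>" by (auto simp: S_def below_iff)
  ultimately show ?case using \<alpha> by (simp add: decomposable_add decomposable_S)
qed

text \<open>Existence is \<open>decomposable_all\<close>. Uniqueness concerns families in the images
  of the \<open>S \<beta>\<close>, so such a family is first lifted to the \<open>S \<beta>\<close>,
  where \<open>components_unique\<close> applies.\<close>

theorem interaction_decomposition_S: "interaction_decomposition K A W j S"
  unfolding interaction_decomposition_def internal_direct_sum_def
proof (intro conjI ballI)
  fix \<alpha> assume \<alpha>: "\<alpha> \<in> A"
  show "Finite_Set.finite {\<beta> \<in> A. \<beta> \<subseteq> \<alpha>}" using finite_below[OF \<alpha>] by (simp add: below_def)
  show "submodule (j \<alpha> \<beta> ` S \<beta>) K (W \<alpha>)" if "\<beta> \<in> {\<beta> \<in> A. \<beta> \<subseteq> \<alpha>}" for \<beta>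
    using that \<alpha> by (auto intro: linear_map.image_submodule[OF j_linear] S_submodule)
  fix x assume x: "x \<in> carrier (W \<alpha>)"
  interpret W: module K "W \<alpha>" using \<alpha> by (rule module_W)
  obtain v where v: "\<And>\<beta>. \<beta> \<in> below \<alpha> \<Longrightarrow> v \<beta> \<in> S \<beta>" "x = (\<Oplus>\<^bsub>W \<alpha>\<^esub>\<beta>\<in>below \<alpha>. j \<alpha> \<beta> (v \<beta>))"
    using decomposable_all[OF \<alpha> x] by (auto simp: decomposable_def)
  have "\<exists>!u. u \<in> (\<Pi>\<^sub>E \<beta>\<in>below \<alpha>. j \<alpha> \<beta> ` S \<beta>) \<and> (\<Oplus>\<^bsub>W \<alpha>\<^esub>\<beta>\<in>below \<alpha>. u \<beta>) = x"
  proof (rule ex1I[of _ "\<lambda>\<beta>\<in>below \<alpha>. j \<alpha> \<beta> (v \<beta>)"])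
    have "(\<Oplus>\<^bsub>W \<alpha>\<^esub>\<beta>\<in>below \<alpha>. (\<lambda>\<beta>\<in>below \<alpha>. j \<alpha> \<beta> (v \<beta>)) \<beta>) = x"
      unfolding v(2) by (rule W.M.finsum_cong') (use \<alpha> v in \<open>auto intro: j_S_closed\<close>)
    then show "(\<lambda>\<beta>\<in>below \<alpha>. j \<alpha> \<beta> (v \<beta>)) \<in> (\<Pi>\<^sub>E \<beta>\<in>below \<alpha>. j \<alpha> \<beta> ` S \<beta>) \<and>
        (\<Oplus>\<^bsub>W \<alpha>\<^esub>\<beta>\<in>below \<alpha>. (\<lambda>\<beta>\<in>below \<alpha>. j \<alpha> \<beta> (v \<beta>)) \<beta>) = x"
      using v by auto
  next
    fix u assume u: "u \<in> (\<Pi>\<^sub>E \<beta>\<in>below \<alpha>. j \<alpha> \<beta> ` S \<beta>) \<and> (\<Oplus>\<^bsub>W \<alpha>\<^esub>\<beta>\<in>below \<alpha>. u \<beta>) = x"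
    \<comment> \<open>Chooses preimages of the given summands under the maps
      \<open>j \<alpha> \<beta>\<close>.\<close>
    then have "\<forall>\<beta>\<in>below \<alpha>. \<exists>w\<in>S \<beta>. u \<beta> = j \<alpha> \<beta> w" by (auto simp: PiE_iff)
    then obtain w where w: "\<And>\<beta>. \<beta> \<in> below \<alpha> \<Longrightarrow> w \<beta> \<in> S \<beta>"
      "\<And>\<beta>. \<beta> \<in> below \<alpha> \<Longrightarrow> u \<beta> = j \<alpha> \<beta> (w \<beta>)" by metis
    have "(\<Oplus>\<^bsub>W \<alpha>\<^esub>\<beta>\<in>below \<alpha>. u \<beta>) = (\<Oplus>\<^bsub>W \<alpha>\<^esub>\<beta>\<in>below \<alpha>. j \<alpha> \<beta> (w \<beta>))"
      by (rule W.M.finsum_cong') (use \<alpha> w in \<open>auto intro: j_S_closed\<close>)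
    with u v(2) have "(\<Oplus>\<^bsub>W \<alpha>\<^esub>\<beta>\<in>below \<alpha>. j \<alpha> \<beta> (w \<beta>)) = (\<Oplus>\<^bsub>W \<alpha>\<^esub>\<beta>\<in>below \<alpha>. j \<alpha> \<beta> (v \<beta>))"
      by simp
    from components_unique[OF \<alpha> w(1) v(1) this]
    have "u \<beta> = j \<alpha> \<beta> (v \<beta>)" if "\<beta> \<in> below \<alpha>" for \<beta>
      using w(2) that by simp
    then show "u = (\<lambda>\<beta>\<in>below \<alpha>. j \<alpha> \<beta> (v \<beta>))"
      using u by (auto simp: PiE_iff extensional_def)
  qed
  then show "\<exists>!u. u \<in> (\<Pi>\<^sub>E \<beta>\<in>{\<beta> \<in> A. \<beta> \<subseteq> \<alpha>}. j \<alpha> \<beta> ` S \<beta>) \<and>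
      (\<Oplus>\<^bsub>W \<alpha>\<^esub>\<beta>\<in>{\<beta> \<in> A. \<beta> \<subseteq> \<alpha>}. u \<beta>) = x"
    by (simp only: below_def)
qed (rule S_submodule)

end

section \<open>Quotients of split presheaves\<close>

lemma quotient_linear_map:
  assumes "linear_map K M M' f" and N: "submodule N K M" and N': "submodule N' K M'"
    and fN: "f ` N \<subseteq> N'"
  shows "linear_map K (quotient_module M N) (quotient_module M' N') (quotient_map M' N' f)"
proof -
  interpret linear_map K M M' f by fact
  note coset = M.quotient_map_coset[OF N N' N.module_axioms hom fN]
  have M: "module K (quotient_module M N)" by (rule M.quotient_is_module[OF N])
  have M': "module K (quotient_module M' N')" by (rule N.quotient_is_module[OF N'])
  have "quotient_map M' N' f \<in>
      hom (add_monoid (quotient_module M N)) (add_monoid (quotient_module M' N'))"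
    by (rule homI)
       (auto elim!: M.quotient_carrierE intro!: N.quotient_carrierI
          simp: coset M.quotient_add_coset[OF N] N.quotient_add_coset[OF N'] add)
  moreover have "quotient_map M' N' f (c \<odot>\<^bsub>quotient_module M N\<^esub> X) =
      c \<odot>\<^bsub>quotient_module M' N'\<^esub> quotient_map M' N' f X"
    if "c \<in> carrier K" "X \<in> carrier (quotient_module M N)" for c X
    using that
    by (auto elim!: M.quotient_carrierE
          simp: coset M.quotient_smult_coset[OF N] N.quotient_smult_coset[OF N'] smult)
  ultimately show ?thesis
    using M M' by (simp add: linear_map_def linear_map_axioms_def)
qed

text \<open>Induced maps act on representatives, so each retraction identity descends from
  \<open>W\<close>. The presheaf part enters as the hypothesis \<open>inj\<close>, which
  \<open>injective_presheaf_reduced_free\<close> supplies for the constants.\<close>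

lemma (in split_presheaf) split_presheaf_quotient:
  assumes N: "\<And>\<alpha>. \<alpha> \<in> A \<Longrightarrow> submodule (N \<alpha>) K (W \<alpha>)"
    and jN: "\<And>\<alpha> \<beta>. \<alpha> \<in> A \<Longrightarrow> \<beta> \<in> A \<Longrightarrow> \<beta> \<subseteq> \<alpha> \<Longrightarrow> j \<alpha> \<beta> ` N \<beta> \<subseteq> N \<alpha>"
    and rN: "\<And>\<alpha> \<beta>. \<alpha> \<in> A \<Longrightarrow> \<beta> \<in> A \<Longrightarrow> \<beta> \<subseteq> \<alpha> \<Longrightarrow> r \<beta> \<alpha> ` N \<alpha> \<subseteq> N \<beta>"
    and inj: "injective_presheaf K A (\<lambda>\<alpha>. quotient_module (W \<alpha>) (N \<alpha>))
      (\<lambda>\<alpha> \<beta>. quotient_map (W \<alpha>) (N \<alpha>) (j \<alpha> \<beta>))"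
  shows "split_presheaf K A (\<lambda>\<alpha>. quotient_module (W \<alpha>) (N \<alpha>))
    (\<lambda>\<alpha> \<beta>. quotient_map (W \<alpha>) (N \<alpha>) (j \<alpha> \<beta>)) (\<lambda>\<beta> \<alpha>. quotient_map (W \<beta>) (N \<beta>) (r \<beta> \<alpha>))"
proof -
  have j_coset: "quotient_map (W \<alpha>) (N \<alpha>) (j \<alpha> \<beta>) (N \<beta> +>\<^bsub>W \<beta>\<^esub> x) = N \<alpha> +>\<^bsub>W \<alpha>\<^esub> j \<alpha> \<beta> x"
    if "\<alpha> \<in> A" "\<beta> \<in> A" "\<beta> \<subseteq> \<alpha>" "x \<in> carrier (W \<beta>)" for \<alpha> \<beta> x
    using that
    by (intro module.quotient_map_coset[OF module_W N N module_W linear_map.hom[OF j_linear] jN])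
  have r_coset: "quotient_map (W \<beta>) (N \<beta>) (r \<beta> \<alpha>) (N \<alpha> +>\<^bsub>W \<alpha>\<^esub> x) = N \<beta> +>\<^bsub>W \<beta>\<^esub> r \<beta> \<alpha> x"
    if "\<alpha> \<in> A" "\<beta> \<in> A" "\<beta> \<subseteq> \<alpha>" "x \<in> carrier (W \<alpha>)" for \<alpha> \<beta> x
    using that
    by (intro module.quotient_map_coset[OF module_W N N module_W linear_map.hom[OF r_linear] rN])
  have rep: "\<exists>x\<in>carrier (W \<alpha>). X = N \<alpha> +>\<^bsub>W \<alpha>\<^esub> x"
    if "\<alpha> \<in> A" "X \<in> carrier (quotient_module (W \<alpha>) (N \<alpha>))" for \<alpha> X
    using module.quotient_carrierE[OF module_W[OF that(1)] that(2)] by blast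
  show ?thesis
  proof (rule split_presheaf.intro)
    show "linear_map K (quotient_module (W \<alpha>) (N \<alpha>)) (quotient_module (W \<beta>) (N \<beta>))
        (quotient_map (W \<beta>) (N \<beta>) (r \<beta> \<alpha>))" if "\<alpha> \<in> A" "\<beta> \<in> A" "\<beta> \<subseteq> \<alpha>" for \<alpha> \<beta>
      using that by (intro quotient_linear_map r_linear N rN)
  next
    fix \<alpha> X assume "\<alpha> \<in> A" "X \<in> carrier (quotient_module (W \<alpha>) (N \<alpha>))"
    with rep[of \<alpha> X] show "quotient_map (W \<alpha>) (N \<alpha>) (r \<alpha> \<alpha>) X = X"
      by (auto simp: r_coset r_id)
  next
    fix \<alpha> \<beta> \<gamma> X
    assume "\<alpha> \<in> A" "\<beta> \<in> A" "\<gamma> \<in> A" "\<gamma> \<subseteq> \<beta>" "\<beta> \<subseteq> \<alpha>"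
      and "X \<in> carrier (quotient_module (W \<alpha>) (N \<alpha>))"
    moreover from this have "\<gamma> \<subseteq> \<alpha>" by simp
    ultimately show "quotient_map (W \<gamma>) (N \<gamma>) (r \<gamma> \<beta>) (quotient_map (W \<beta>) (N \<beta>) (r \<beta> \<alpha>) X) =
        quotient_map (W \<gamma>) (N \<gamma>) (r \<gamma> \<alpha>) X"
      using rep[of \<alpha> X] by (auto simp: r_coset r_closed r_comp)
  next
    fix \<alpha> \<beta> \<gamma> X
    assume "\<alpha> \<in> A" "\<beta> \<in> A" "\<gamma> \<in> A" "\<beta> \<subseteq> \<alpha>" "\<gamma> \<subseteq> \<alpha>"
      and "X \<in> carrier (quotient_module (W \<gamma>) (N \<gamma>))"
    moreover from this have "\<beta> \<inter> \<gamma> \<in> A" by (intro Int_mem)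
    ultimately show "quotient_map (W \<beta>) (N \<beta>) (r \<beta> \<alpha>) (quotient_map (W \<alpha>) (N \<alpha>) (j \<alpha> \<gamma>) X) =
        quotient_map (W \<beta>) (N \<beta>) (j \<beta> (\<beta> \<inter> \<gamma>))
          (quotient_map (W (\<beta> \<inter> \<gamma>)) (N (\<beta> \<inter> \<gamma>)) (r (\<beta> \<inter> \<gamma>) \<gamma>) X)"
      using rep[of \<gamma> X] by (auto simp: r_coset j_coset r_closed j_closed r_j)
  qed (use inj finite Int_mem in auto)
qed

section \<open>Retractions of the free presheaf\<close>

text \<open>For \<beta> \<subseteq> \<alpha> this is the section of the projection from the product
  over \<alpha> to the product over \<beta> determined by the base point \<open>b\<close>.\<close>

definition fill :: "('i \<Rightarrow> 'e) \<Rightarrow> 'i set \<Rightarrow> 'i set \<Rightarrow> ('i \<Rightarrow> 'e) \<Rightarrow> 'i \<Rightarrow> 'e" where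
  "fill b \<alpha> \<beta> y = (\<lambda>i\<in>\<alpha>. if i \<in> \<beta> then y i else b i)"

text \<open>Pullback along \<open>fill\<close>, just as \<open>free_presheaf_map\<close> is pullback
  along \<open>product_proj\<close>.\<close>

definition free_retraction ::
  "('i \<Rightarrow> 'e set) \<Rightarrow> ('i \<Rightarrow> 'e) \<Rightarrow> 'i set \<Rightarrow> 'i set \<Rightarrow> (('i \<Rightarrow> 'e) \<Rightarrow> 'k) \<Rightarrow> (('i \<Rightarrow> 'e) \<Rightarrow> 'k)" where
  "free_retraction E b \<beta> \<alpha> f = (\<lambda>y\<in>product_obj E \<beta>. f (fill b \<alpha> \<beta> y))"

lemma fill_in:
  assumes "\<And>i. i \<in> \<alpha> \<Longrightarrow> b i \<in> E i" "y \<in> product_obj E \<beta>"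
  shows "fill b \<alpha> \<beta> y \<in> product_obj E \<alpha>"
  using assms by (auto simp: fill_def product_obj_def)

lemma fill_id: "y \<in> product_obj E \<alpha> \<Longrightarrow> fill b \<alpha> \<alpha> y = y"
  by (auto simp: fill_def product_obj_def fun_eq_iff PiE_iff extensional_def)

lemma fill_fill: "\<gamma> \<subseteq> \<beta> \<Longrightarrow> \<beta> \<subseteq> \<alpha> \<Longrightarrow> fill b \<alpha> \<beta> (fill b \<beta> \<gamma> z) = fill b \<alpha> \<gamma> z"
  by (auto simp: fill_def fun_eq_iff)

text \<open>On \<gamma> both sides read \<open>y\<close> at the indices in \<beta> and
  \<open>b\<close> at the others. Pulling functions back along the two sides gives
  \<open>r_j\<close>.\<close>

lemma product_proj_fill:
  "\<gamma> \<subseteq> \<alpha> \<Longrightarrow>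
    product_proj \<gamma> (fill b \<alpha> \<beta> y) = fill b \<gamma> (\<beta> \<inter> \<gamma>) (product_proj (\<beta> \<inter> \<gamma>) y)"
  by (auto simp: fill_def product_proj_def fun_eq_iff)

lemma free_retraction_linear:
  assumes "cring K" "\<And>i. i \<in> \<alpha> \<Longrightarrow> b i \<in> E i"
  shows "linear_map K (free_presheaf K E \<alpha>) (free_presheaf K E \<beta>) (free_retraction E b \<beta> \<alpha>)"
proof -
  have "module K (free_presheaf K E \<gamma>)" for \<gamma>
    unfolding free_presheaf_def using assms(1) by (rule function_space_module)
  then show ?thesis
    unfolding linear_map_def linear_map_axioms_def using fill_in[of \<alpha> b E _ \<beta>, OF assms(2)]
    by (auto simp: hom_def free_presheaf_def function_space_def free_retraction_def fun_eq_iff PiE_iff)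
qed

text \<open>The identities for pullbacks reduce to identities between points:
  \<open>fill_id\<close>, \<open>fill_fill\<close> and \<open>product_proj_fill\<close> yield
  \<open>r_id\<close>, \<open>r_comp\<close> and \<open>r_j\<close>. Membership of the filled
  points, by \<open>fill_in\<close>, is what allows the restricted functions to be evaluated
  there.\<close>

lemma split_presheaf_free:
  fixes K :: "('k, 'm) ring_scheme" and E :: "'i \<Rightarrow> 'e set"
  assumes K: "field K" and hyp: "hypergraph A I" and b: "\<And>i. i \<in> I \<Longrightarrow> b i \<in> E i"
    and A: "strong_intersection_property A"
  shows "split_presheaf K A (free_presheaf K E) (free_presheaf_map E) (free_retraction E b)"
proof -
  interpret field K by fact
  have b\<alpha>: "b i \<in> E i" if "\<alpha> \<in> A" "i \<in> \<alpha>" for i \<alpha>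
    using that hyp b by (auto simp: hypergraph_def)
  note fill_in = fill_in[of _ b E, OF b\<alpha>]
  show ?thesis
  proof (rule split_presheaf.intro)
    show "injective_presheaf K A (free_presheaf K E) (free_presheaf_map E)"
      using b by (intro injective_presheaf_free[OF K hyp]) auto
    show "linear_map K (free_presheaf K E \<alpha>) (free_presheaf K E \<beta>) (free_retraction E b \<beta> \<alpha>)"
      if "\<alpha> \<in> A" for \<alpha> \<beta>
      using that by (intro free_retraction_linear is_cring b\<alpha>)
  next
    fix \<alpha> and f :: "('i \<Rightarrow> 'e) \<Rightarrow> 'k" assume "f \<in> carrier (free_presheaf K E \<alpha>)"
    then show "free_retraction E b \<alpha> \<alpha> f = f"
      by (auto simp: free_retraction_def free_presheaf_def function_space_def fun_eq_iff PiE_iff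
            fill_id extensional_def[of "product_obj E \<alpha>"])
  next
    fix \<alpha> \<beta> \<gamma> and f :: "('i \<Rightarrow> 'e) \<Rightarrow> 'k"
    assume "\<beta> \<in> A" "\<gamma> \<subseteq> \<beta>" "\<beta> \<subseteq> \<alpha>"
    then show "free_retraction E b \<gamma> \<beta> (free_retraction E b \<beta> \<alpha> f) = free_retraction E b \<gamma> \<alpha> f"
      by (auto simp: free_retraction_def fun_eq_iff fill_in fill_fill)
  next
    fix \<alpha> \<beta> \<gamma> and f :: "('i \<Rightarrow> 'e) \<Rightarrow> 'k"
    assume "\<alpha> \<in> A" "\<beta> \<in> A" "\<beta> \<subseteq> \<alpha>" "\<gamma> \<subseteq> \<alpha>"
    then show "free_retraction E b \<beta> \<alpha> (free_presheaf_map E \<alpha> \<gamma> f) =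
        free_presheaf_map E \<beta> (\<beta> \<inter> \<gamma>) (free_retraction E b (\<beta> \<inter> \<gamma>) \<gamma> f)"
      using product_proj_in[of "\<beta> \<inter> \<gamma>" \<beta> _ E]
      by (auto simp: free_retraction_def free_presheaf_map_def fun_eq_iff fill_in product_proj_fill)
  qed (use hyp A in \<open>auto simp: hypergraph_def strong_intersection_property_def\<close>)
qed

text \<open>A pullback sends a constant function to the constant function with the same value, so
  inclusions and retractions both respect the lines that are divided out.\<close>

lemma split_presheaf_reduced_free:
  fixes K :: "('k, 'm) ring_scheme" and E :: "'i \<Rightarrow> 'e set"
  assumes K: "field K" and hyp: "hypergraph A I" and b: "\<And>i. i \<in> I \<Longrightarrow> b i \<in> E i"
    and A: "strong_intersection_property A"
  shows "split_presheaf K A (reduced_free_presheaf K E) (reduced_free_presheaf_map K E)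
    (\<lambda>\<beta> \<alpha>. quotient_map (free_presheaf K E \<beta>) (constant_functions K (product_obj E \<beta>))
      (free_retraction E b \<beta> \<alpha>))"
proof -
  interpret field K by fact
  interpret split_presheaf K A "free_presheaf K E" "free_presheaf_map E" "free_retraction E b"
    using assms by (rule split_presheaf_free)
  have b\<alpha>: "b i \<in> E i" if "\<alpha> \<in> A" "i \<in> \<alpha>" for i \<alpha>
    using that hyp b by (auto simp: hypergraph_def)
  have j: "free_presheaf_map E \<alpha> \<beta> (\<lambda>x\<in>product_obj E \<beta>. c) = (\<lambda>x\<in>product_obj E \<alpha>. c)"
    if "\<beta> \<subseteq> \<alpha>" for \<alpha> \<beta> and c :: 'k
    using product_proj_in[OF that] by (auto simp: free_presheaf_map_def fun_eq_iff)
  have r: "free_retraction E b \<beta> \<alpha> (\<lambda>x\<in>product_obj E \<alpha>. c) = (\<lambda>x\<in>product_obj E \<beta>. c)"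
    if "\<alpha> \<in> A" for \<alpha> \<beta> and c :: 'k
    using fill_in[of \<alpha> b E _ \<beta>] b\<alpha>[OF that] by (auto simp: free_retraction_def fun_eq_iff)
  show ?thesis
    unfolding reduced_free_presheaf_def[abs_def] reduced_free_presheaf_map_def[abs_def]
  proof (rule split_presheaf_quotient)
    show "submodule (constant_functions K (product_obj E \<alpha>)) K (free_presheaf K E \<alpha>)" for \<alpha>
      unfolding free_presheaf_def by (rule constant_functions_submodule[OF is_cring])
    show "injective_presheaf K A
        (\<lambda>\<alpha>. quotient_module (free_presheaf K E \<alpha>) (constant_functions K (product_obj E \<alpha>)))
        (\<lambda>\<alpha> \<beta>. quotient_map (free_presheaf K E \<alpha>) (constant_functions K (product_obj E \<alpha>))
          (free_presheaf_map E \<alpha> \<beta>))"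
      using injective_presheaf_reduced_free[OF K hyp, of E] b
      unfolding reduced_free_presheaf_def[abs_def] reduced_free_presheaf_map_def[abs_def] by blast
  qed (auto simp: constant_functions_def j r)
qed

section \<open>Removing the empty set\<close>

text \<open>Families over \<open>B\<close> and over \<open>insert b B\<close> correspond by
  restriction and by extension with zero at \<open>b\<close>, and corresponding families have the
  same sum.\<close>

lemma internal_direct_sum_remove_zero:
  assumes M: "module K M" and b: "b \<notin> B" "U b = {\<zero>\<^bsub>M\<^esub>}"
    and sum: "internal_direct_sum K M (insert b B) U"
  shows "internal_direct_sum K M B U"
proof -
  interpret module K M by fact
  have fin: "finite B" and sub: "\<And>c. c \<in> B \<Longrightarrow> submodule (U c) K M"
    using sum by (auto simp: internal_direct_sum_def)
  have extend: "u(b := \<zero>\<^bsub>M\<^esub>) \<in> Pi\<^sub>E (insert b B) U \<and>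
      (\<Oplus>\<^bsub>M\<^esub>c\<in>insert b B. (u(b := \<zero>\<^bsub>M\<^esub>)) c) = (\<Oplus>\<^bsub>M\<^esub>c\<in>B. u c)" if u: "u \<in> Pi\<^sub>E B U" for u
  proof
    have uM: "u \<in> B \<rightarrow> carrier M" using u sub submoduleE(1) by (fastforce simp: PiE_iff)
    have "(\<Oplus>\<^bsub>M\<^esub>c\<in>B. (u(b := \<zero>\<^bsub>M\<^esub>)) c) = (\<Oplus>\<^bsub>M\<^esub>c\<in>B. u c)"
      using uM b by (intro M.finsum_cong') auto
    moreover have "(\<Oplus>\<^bsub>M\<^esub>c\<in>B. u c) \<in> carrier M" using uM by (rule M.finsum_closed)
    ultimately show "(\<Oplus>\<^bsub>M\<^esub>c\<in>insert b B. (u(b := \<zero>\<^bsub>M\<^esub>)) c) = (\<Oplus>\<^bsub>M\<^esub>c\<in>B. u c)"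
      using uM b fin by (subst M.finsum_insert) (auto simp del: fun_upd_apply simp: fun_upd_same)
    show "u(b := \<zero>\<^bsub>M\<^esub>) \<in> Pi\<^sub>E (insert b B) U"
      using u b by (auto simp: PiE_iff extensional_def)
  qed
  have "\<exists>!u. u \<in> Pi\<^sub>E B U \<and> (\<Oplus>\<^bsub>M\<^esub>c\<in>B. u c) = x" if x: "x \<in> carrier M" for x
  proof -
    have uniq: "\<exists>!w. w \<in> Pi\<^sub>E (insert b B) U \<and> (\<Oplus>\<^bsub>M\<^esub>c\<in>insert b B. w c) = x"
      using sum x by (auto simp: internal_direct_sum_def)
    then obtain w where w: "w \<in> Pi\<^sub>E (insert b B) U" "(\<Oplus>\<^bsub>M\<^esub>c\<in>insert b B. w c) = x" by auto
    have rw: "restrict w B \<in> Pi\<^sub>E B U" using w by auto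
    \<comment> \<open>The value of \<open>w\<close> at \<open>b\<close> is forced to be zero by
      \<open>U b\<close>, so restricting loses nothing.\<close>
    have "(restrict w B)(b := \<zero>\<^bsub>M\<^esub>) = w"
      using w(1) b by (auto simp: PiE_iff extensional_def fun_eq_iff)
    then have rx: "(\<Oplus>\<^bsub>M\<^esub>c\<in>B. restrict w B c) = x" using extend[OF rw] w(2) by simp
    show ?thesis
    proof (rule ex1I[of _ "restrict w B"])
      fix u assume u: "u \<in> Pi\<^sub>E B U \<and> (\<Oplus>\<^bsub>M\<^esub>c\<in>B. u c) = x"
      then have "u(b := \<zero>\<^bsub>M\<^esub>) = w" using uniq extend[of u] w by blast
      then have "u c = w c" if "c \<in> B" for c using that b by auto
      then show "u = restrict w B" using u by (auto simp: PiE_iff extensional_def fun_eq_iff)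
    qed (use rw rx in auto)
  qed
  then show ?thesis using fin sub by (auto simp: internal_direct_sum_def)
qed

text \<open>The summand at \<open>{}\<close> is the image of a subspace of a zero space, hence zero
  in every \<open>W \<alpha>\<close>. If \<open>{}\<close> already belongs to \<open>A\<close>, the
  two index sets coincide.\<close>

lemma interaction_decomposition_remove_empty:
  assumes W: "injective_presheaf K (insert {} A) W j"
    and zero: "carrier (W {}) = {\<zero>\<^bsub>W {}\<^esub>}"
    and S: "interaction_decomposition K (insert {} A) W j S"
  shows "interaction_decomposition K A W j S"
proof (cases "{} \<in> A")
  case True
  then show ?thesis using S by (simp add: insert_absorb)
next
  case False
  have mod: "module K (W \<alpha>)" if "\<alpha> \<in> insert {} A" for \<alpha>
    using W that by (auto simp: injective_presheaf_def)
  interpret W0: module K "W {}" by (rule mod) simp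
  have S0: "S {} = {\<zero>\<^bsub>W {}\<^esub>}"
    using S zero W0.submoduleE(1,2)[of "S {}"] by (auto simp: interaction_decomposition_def)
  have "internal_direct_sum K (W \<alpha>) {\<beta> \<in> A. \<beta> \<subseteq> \<alpha>} (\<lambda>\<beta>. j \<alpha> \<beta> ` S \<beta>)" if \<alpha>: "\<alpha> \<in> A" for \<alpha>
  proof (rule internal_direct_sum_remove_zero)
    show "module K (W \<alpha>)" using \<alpha> by (intro mod) simp
    have "linear_map K (W {}) (W \<alpha>) (j \<alpha> {})"
      using W \<alpha> mod by (auto simp: injective_presheaf_def linear_map_def linear_map_axioms_def)
    then show "j \<alpha> {} ` S {} = {\<zero>\<^bsub>W \<alpha>\<^esub>}" by (simp add: S0 linear_map.zero)
    have "insert {} {\<beta> \<in> A. \<beta> \<subseteq> \<alpha>} = {\<beta> \<in> insert {} A. \<beta> \<subseteq> \<alpha>}" by auto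
    then show "internal_direct_sum K (W \<alpha>) (insert {} {\<beta> \<in> A. \<beta> \<subseteq> \<alpha>}) (\<lambda>\<beta>. j \<alpha> \<beta> ` S \<beta>)"
      using S \<alpha> by (simp add: interaction_decomposition_def)
  qed (use False in simp)
  then show ?thesis using S by (simp add: interaction_decomposition_def)
qed

text \<open>The empty product is a singleton, so every function on it is constant and the quotient
  has a single coset.\<close>

lemma reduced_free_presheaf_empty:
  assumes "cring K"
  shows "carrier (reduced_free_presheaf K E {}) = {\<zero>\<^bsub>reduced_free_presheaf K E {}\<^esub>}"
proof -
  let ?X = "product_obj E {}"
  interpret F: module K "function_space K ?X" using assms by (rule function_space_module)
  have C: "submodule (constant_functions K ?X) K (function_space K ?X)"
    using assms by (rule constant_functions_submodule)
  interpret C: abelian_subgroup "constant_functions K ?X" "function_space K ?X"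
    using C by (rule F.submodule_abelian_subgroup)
  have "f \<in> constant_functions K ?X" if "f \<in> carrier (function_space K ?X)" for f
  proof -
    \<comment> \<open>The one point of the empty product is the function that is
      \<open>undefined\<close> everywhere.\<close>
    have X: "?X = {\<lambda>_. undefined}" by (simp add: product_obj_def)
    have "f = (\<lambda>x\<in>?X. f (\<lambda>_. undefined))"
      by (rule ext) (use that in \<open>auto simp: function_space_def X PiE_iff extensional_def\<close>)
    moreover have "f (\<lambda>_. undefined) \<in> carrier K"
      using that by (auto simp: function_space_def X)
    ultimately show ?thesis unfolding constant_functions_def by blast
  qed
  then have coset: "constant_functions K ?X +>\<^bsub>function_space K ?X\<^esub> f = constant_functions K ?X"
    if "f \<in> carrier (function_space K ?X)" for f
    using that C.a_rcos_const by blast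
  have "carrier (quotient_module (function_space K ?X) (constant_functions K ?X)) =
      {constant_functions K ?X}"
  proof (intro equalityI subsetI)
    fix Y assume "Y \<in> carrier (quotient_module (function_space K ?X) (constant_functions K ?X))"
    then obtain f where "f \<in> carrier (function_space K ?X)"
      "Y = constant_functions K ?X +>\<^bsub>function_space K ?X\<^esub> f"
      by (rule F.quotient_carrierE)
    then show "Y \<in> {constant_functions K ?X}" by (simp only: coset) simp
  next
    show "Y \<in> carrier (quotient_module (function_space K ?X) (constant_functions K ?X))"
      if "Y \<in> {constant_functions K ?X}" for Y
      using that F.quotient_carrierI[OF F.zero_closed] coset[OF F.zero_closed] by (metis singletonD)
  qed
  then show ?thesis
    by (simp add: reduced_free_presheaf_def free_presheaf_def quotient_module_def)
qed

section \<open>Decompositions of the free and the reduced free presheaf\<close>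

theorem theorem5p7:
  fixes K :: "('k, 'm) ring_scheme"
    and A :: "'i set set" and I :: "'i set" and E :: "'i \<Rightarrow> 'e set"
  assumes "field K"
    and "hypergraph A I"
    and "\<And>i. i \<in> I \<Longrightarrow> E i \<noteq> {}"
  shows "(strong_intersection_property A \<longrightarrow>
            (\<exists>S. interaction_decomposition K A (free_presheaf K E) (free_presheaf_map E) S)) \<and>
         (weak_intersection_property A \<longrightarrow>
            (\<exists>S. interaction_decomposition K A (reduced_free_presheaf K E)
                   (reduced_free_presheaf_map K E) S))"
proof (intro conjI impI)
  interpret field K by fact
  \<comment> \<open>Non-emptiness of the sets \<open>E i\<close> provides the base point for the
    retractions.\<close>
  have b: "(SOME e. e \<in> E i) \<in> E i" if "i \<in> I" for i
    using assms(3)[OF that] by (simp add: some_in_eq)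
  show "\<exists>S. interaction_decomposition K A (free_presheaf K E) (free_presheaf_map E) S"
    if "strong_intersection_property A"
    using split_presheaf.interaction_decomposition_S
      [OF split_presheaf_free[where E = E, OF assms(1,2) b that]] by blast
  assume weak: "weak_intersection_property A"
  have hyp: "hypergraph (insert {} A) I" using assms(2) by (auto simp: hypergraph_def)
  \<comment> \<open>The weak property lacks only the empty intersections, and these lie in
    \<open>insert {} A\<close>.\<close>
  have strong: "strong_intersection_property (insert {} A)"
    using weak by (auto simp: weak_intersection_property_def strong_intersection_property_def)
  have inj: "injective_presheaf K (insert {} A) (reduced_free_presheaf K E)
      (reduced_free_presheaf_map K E)"
    using assms(1) hyp assms(3) by (rule injective_presheaf_reduced_free)
  note S = split_presheaf.interaction_decomposition_S
    [OF split_presheaf_reduced_free[where E = E, OF assms(1) hyp b strong]]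
  show "\<exists>S. interaction_decomposition K A (reduced_free_presheaf K E)
      (reduced_free_presheaf_map K E) S"
    using interaction_decomposition_remove_empty[OF inj reduced_free_presheaf_empty[OF is_cring] S]
    by blast
qed

end
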